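(* There is an absolute constant $c>0$ such that the following holds. Let $p$ be a prime and let $f_1, f_2:\mathbb F_p \to\mathbb C$. Define $F:\mathbb F_p\to\mathbb C$ by $$F(x) =\frac 1p \sum_{y\in \mathbb F_p^*} f_1 (x+y)\, f_2\Big(x+\frac 1y\Big),$$ where $\frac1y$ denotes the multiplicative inverse of $y$ in $\mathbb F_p$. Then $$\big\Vert F- \mathbb E [f_1]\cdot \mathbb E[f_2]\big\Vert_2 \leq c\,p^{-\frac 1{10}} \Vert f_1\Vert_2\cdot \Vert f_2\Vert_2.$$
   Context: For $f:\mathbb F_p\to\mathbb C$, $\mathbb E[f]=\frac1p\sum_{x\in\mathbb F_p} f(x)$ and $\Vert f\Vert_2=\big(\frac1p\sum_{x\in\mathbb F_p}|f(x)|^2\big)^{1/2}$ (normalized counting measure). $\mathbb F_p^*=\mathbb F_p\setminus\{0\}$. In $F-\mathbb E[f_1]\cdot\mathbb E[f_2]$, the product denotes the constant function. *)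

theory Defs
  imports "HOL-Analysis.Analysis"
begin

text \<open>F_p is modelled as the residues {0..<p} (naturals), with addition (x + y) mod p.
  Functions F_p -> C are functions nat => complex, only their values on {0..<p} matter.\<close>

definition fp_inv :: "nat \<Rightarrow> nat \<Rightarrow> nat" where
  "fp_inv p y = (THE z. z < p \<and> (y * z) mod p = 1)"

definition fp_mean :: "nat \<Rightarrow> (nat \<Rightarrow> complex) \<Rightarrow> complex" where
  "fp_mean p f = (\<Sum>x<p. f x) / of_nat p"

definition fp_norm2 :: "nat \<Rightarrow> (nat \<Rightarrow> complex) \<Rightarrow> real" where
  "fp_norm2 p f = sqrt ((\<Sum>x<p. (cmod (f x))\<^sup>2) / real p)"

definition conv_F :: "nat \<Rightarrow> (nat \<Rightarrow> complex) \<Rightarrow> (nat \<Rightarrow> complex) \<Rightarrow> nat \<Rightarrow> complex" where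
  "conv_F p f1 f2 x = (\<Sum>y\<in>{1..<p}. f1 ((x + y) mod p) * f2 ((x + fp_inv p y) mod p)) / of_nat p"

end

theory Submission
  imports Defs "HOL-Number_Theory.Cong"
begin

text \<open>
  Subtracting its mean from \<open>f\<^sub>1\<close> costs only \<open>O(1/p)\<close>, so assume that \<open>f\<^sub>1\<close> has mean zero. Expanding the square of the sum over \<open>y\<close> in \<open>F\<close>
  and taking Fourier transforms in the translation variable leaves, for every frequency \<open>\<xi>\<close>,
  a bilinear form in the correlations of \<open>f\<^sub>1\<close> at distance \<open>d = y - y'\<close> and of \<open>f\<^sub>2\<close> at distance
  \<open>1/y - 1/y'\<close>, with unimodular entries. Its operator norm is bounded through the Hilbert-Schmidt norm of
  its Gram matrix. The Gram entry at \<open>(d, e)\<close> is an exponential sum over the conic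
  \<open>d z (z - e) = e y (y - d)\<close>. Parametrised by \<open>w = d z / y\<close>, its phase depends on \<open>d, e\<close> only through
  \<open>m = d e\<close> and \<open>s = d + e\<close>, and it is linear in \<open>s\<close>. Orthogonality in \<open>s\<close> therefore gives
  square-root cancellation on average over \<open>(d, e)\<close>, without Weil's bound. The result is a
  saving of \<open>p\<^bsup>-1/8\<^esup>\<close>, more than the exponent \<open>1/10\<close> asks for.
\<close>

section \<open>Inequalities for finite sums: fibres, Cauchy-Schwarz, bilinear forms\<close>

lemma sum_fibre_le:
  fixes f :: "'b \<Rightarrow> real"
  assumes "finite A" "finite B" "g ` A \<subseteq> B" "\<And>b. b \<in> B \<Longrightarrow> 0 \<le> f b"
    and k: "\<And>b. b \<in> B \<Longrightarrow> card {a \<in> A. g a = b} \<le> k"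
  shows "(\<Sum>a\<in>A. f (g a)) \<le> k * (\<Sum>b\<in>B. f b)"
proof -
  have "(\<Sum>a\<in>A. f (g a)) = (\<Sum>b\<in>B. \<Sum>a\<in>{a \<in> A. g a = b}. f (g a))"
    using sum.group[OF assms(1-3), of "\<lambda>a. f (g a)"] by simp
  also have "\<dots> = (\<Sum>b\<in>B. card {a \<in> A. g a = b} * f b)"
    by (intro sum.cong refl) (simp add: sum_constant)
  also have "\<dots> \<le> (\<Sum>b\<in>B. k * f b)"
    using assms by (intro sum_mono mult_right_mono) auto
  finally show ?thesis by (simp add: sum_distrib_left)
qed

lemma card_subset_pair: "A \<subseteq> {a, b} \<Longrightarrow> card A \<le> 2"
  by (rule order_trans[OF card_mono[of "{a, b}"]]) (auto simp: card_insert_if)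

lemma of_real_eq_norm: "complex_of_real x = z \<Longrightarrow> 0 \<le> x \<Longrightarrow> x = cmod z"
  by auto

lemma norm_diff_sq_le: "(cmod (a - b))\<^sup>2 \<le> 2 * (cmod a)\<^sup>2 + 2 * (cmod b)\<^sup>2"
proof -
  have "(cmod (a - b))\<^sup>2 \<le> (cmod a + cmod b)\<^sup>2"
    by (intro power_mono norm_triangle_ineq4) simp
  also have "\<dots> \<le> 2 * (cmod a)\<^sup>2 + 2 * (cmod b)\<^sup>2"
    using zero_le_power2[of "cmod a - cmod b"] by (simp add: power2_eq_square algebra_simps)
  finally show ?thesis .
qed

lemma norm_sum_sq:
  fixes c :: "'b \<Rightarrow> complex"
  shows "of_real ((cmod (\<Sum>x\<in>A. c x))\<^sup>2) = (\<Sum>x\<in>A. \<Sum>y\<in>A. c x * cnj (c y))"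
  unfolding complex_norm_square by (simp add: sum_product)

lemma norm_sum_mult_le:
  fixes a b :: "'a \<Rightarrow> complex"
  shows "(cmod (\<Sum>x\<in>A. a x * b x))\<^sup>2 \<le> (\<Sum>x\<in>A. (cmod (a x))\<^sup>2) * (\<Sum>x\<in>A. (cmod (b x))\<^sup>2)"
proof -
  have "cmod (\<Sum>x\<in>A. a x * b x) \<le> (\<Sum>x\<in>A. cmod (a x) * cmod (b x))"
    by (rule order_trans[OF norm_sum]) (simp add: norm_mult)
  then have "(cmod (\<Sum>x\<in>A. a x * b x))\<^sup>2 \<le> (\<Sum>x\<in>A. cmod (a x) * cmod (b x))\<^sup>2"
    by (intro power_mono) auto
  also have "\<dots> \<le> (\<Sum>x\<in>A. (cmod (a x))\<^sup>2) * (\<Sum>x\<in>A. (cmod (b x))\<^sup>2)"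
    by (rule Cauchy_Schwarz_ineq_sum)
  finally show ?thesis .
qed

text \<open>Terms are grouped by the column \<open>c = k d y\<close>, and Cauchy-Schwarz over
  \<open>c\<close> removes \<open>\<psi>\<close>. Expanding the remaining square gives the Gram
  matrix of the rows: its entry at \<open>d\<close>, \<open>e\<close> collects the pairs that meet
  in one column.\<close>

lemma norm_bilinear_sum_le:
  fixes \<phi> :: "'a \<Rightarrow> complex" and u :: "'a \<Rightarrow> 'b \<Rightarrow> complex" and \<psi> :: "'c \<Rightarrow> complex"
  assumes fin: "finite D" "\<And>d. finite (Y d)" "finite C"
    and k: "\<And>d y. d \<in> D \<Longrightarrow> y \<in> Y d \<Longrightarrow> k d y \<in> C"
  shows "(cmod (\<Sum>d\<in>D. \<Sum>y\<in>Y d. \<phi> d * \<psi> (k d y) * u d y))\<^sup>2 \<le> (\<Sum>c\<in>C. (cmod (\<psi> c))\<^sup>2) *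
    cmod (\<Sum>d\<in>D. \<Sum>e\<in>D. \<phi> d * cnj (\<phi> e) *
      (\<Sum>(y, z)\<in>{(y, z). y \<in> Y d \<and> z \<in> Y e \<and> k d y = k e z}. u d y * cnj (u e z)))"
proof -
  define G where "G c = (\<Sum>d\<in>D. \<phi> d * (\<Sum>y\<in>{y \<in> Y d. k d y = c}. u d y))" for c
  have "(\<Sum>d\<in>D. \<Sum>y\<in>Y d. \<phi> d * \<psi> (k d y) * u d y)
      = (\<Sum>d\<in>D. \<Sum>c\<in>C. \<Sum>y\<in>{y \<in> Y d. k d y = c}. \<phi> d * \<psi> (k d y) * u d y)"
    using fin k by (intro sum.cong refl sum.group[symmetric]) auto
  also have "\<dots> = (\<Sum>c\<in>C. \<Sum>d\<in>D. \<Sum>y\<in>{y \<in> Y d. k d y = c}. \<phi> d * \<psi> (k d y) * u d y)"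
    by (rule sum.swap)
  also have "\<dots> = (\<Sum>c\<in>C. \<psi> c * G c)"
    unfolding G_def sum_distrib_left by (intro sum.cong refl) (auto simp: mult_ac)
  finally have "(cmod (\<Sum>d\<in>D. \<Sum>y\<in>Y d. \<phi> d * \<psi> (k d y) * u d y))\<^sup>2
      \<le> (\<Sum>c\<in>C. (cmod (\<psi> c))\<^sup>2) * (\<Sum>c\<in>C. (cmod (G c))\<^sup>2)"
    by (simp only: norm_sum_mult_le)
  moreover have "complex_of_real (\<Sum>c\<in>C. (cmod (G c))\<^sup>2) = (\<Sum>d\<in>D. \<Sum>e\<in>D. \<phi> d * cnj (\<phi> e) *
      (\<Sum>(y, z)\<in>{(y, z). y \<in> Y d \<and> z \<in> Y e \<and> k d y = k e z}. u d y * cnj (u e z)))"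
 (is "_ = ?X")
  proof -
    have "complex_of_real (\<Sum>c\<in>C. (cmod (G c))\<^sup>2) = (\<Sum>c\<in>C. \<Sum>d\<in>D. \<Sum>e\<in>D. \<phi> d * cnj (\<phi> e) *
      (\<Sum>y\<in>{y \<in> Y d. k d y = c}. \<Sum>z\<in>{z \<in> Y e. k e z = c}. u d y * cnj (u e z)))"
      unfolding of_real_sum complex_norm_square G_def
      by (simp add: sum_product cnj_sum mult_ac)
    also have "\<dots> = (\<Sum>d\<in>D. \<Sum>c\<in>C. \<Sum>e\<in>D. \<phi> d * cnj (\<phi> e) *
      (\<Sum>y\<in>{y \<in> Y d. k d y = c}. \<Sum>z\<in>{z \<in> Y e. k e z = c}. u d y * cnj (u e z)))"
      by (rule sum.swap)
    also have "\<dots> = (\<Sum>d\<in>D. \<Sum>e\<in>D. \<Sum>c\<in>C. \<phi> d * cnj (\<phi> e) *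
      (\<Sum>y\<in>{y \<in> Y d. k d y = c}. \<Sum>z\<in>{z \<in> Y e. k e z = c}. u d y * cnj (u e z)))"
      by (intro sum.cong refl sum.swap)
    also have "\<dots> = (\<Sum>d\<in>D. \<Sum>e\<in>D. \<phi> d * cnj (\<phi> e) *
      (\<Sum>c\<in>C. \<Sum>(y, z)\<in>{y \<in> Y d. k d y = c} \<times> {z \<in> Y e. k e z = c}. u d y * cnj (u e z)))"
      by (simp add: sum_distrib_left sum.cartesian_product)
    also have "\<dots> = (\<Sum>d\<in>D. \<Sum>e\<in>D. \<phi> d * cnj (\<phi> e) *
      (\<Sum>(y, z)\<in>{(y, z). y \<in> Y d \<and> z \<in> Y e \<and> k d y = k e z}. u d y * cnj (u e z)))"
    proof (intro sum.cong refl arg_cong2[of _ _ _ _ "(*)"])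
      fix d e assume "d \<in> D" "e \<in> D"
      let ?P = "{(y, z). y \<in> Y d \<and> z \<in> Y e \<and> k d y = k e z}"
      have "finite ?P" by (rule finite_subset[of _ "Y d \<times> Y e"]) (auto simp: fin)
      moreover have "{y \<in> Y d. k d y = c} \<times> {z \<in> Y e. k e z = c} = {x \<in> ?P. k d (fst x) = c}" for c
        by auto
      ultimately show "(\<Sum>c\<in>C. \<Sum>(y, z)\<in>{y \<in> Y d. k d y = c} \<times> {z \<in> Y e. k e z = c}. u d y * cnj (u e z))
         = (\<Sum>(y, z)\<in>?P. u d y * cnj (u e z))"
        using sum.group[of ?P C "\<lambda>x. k d (fst x)" "\<lambda>(y, z). u d y * cnj (u e z)"] fin k \<open>d \<in> D\<close> by force
    qed
    finally show ?thesis .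
  qed
  then have "(\<Sum>c\<in>C. (cmod (G c))\<^sup>2) = cmod ?X"
    by (rule of_real_eq_norm) (simp add: sum_nonneg)
  ultimately show ?thesis by simp
qed

subsection \<open>Residues, inverses and additive characters\<close>

locale residues_mod_prime =
  fixes p :: nat
  assumes prime_p: "prime p"
begin

abbreviation congp :: "int \<Rightarrow> int \<Rightarrow> bool" (infix "\<doteq>" 50)
  where "a \<doteq> b \<equiv> [a = b] (mod int p)"

text \<open>Integers, unlike the naturals of \<open>conv_F\<close>, allow subtraction. Identities
  are stated as congruences; representatives serve as index sets for sums over the field and its
  units.\<close>

definition R :: "int set" where "R = {0..<int p}"

definition U :: "int set" where "U = {1..<int p}"

text \<open>The standard additive character of the field.\<close>

definition ech :: "int \<Rightarrow> complex"
  where "ech x = cis (2 * pi * of_int x / of_nat p)"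

text \<open>Reducing the argument first makes the inverse a function of the residue class. On the
  zero class it is the arbitrary value of an unsatisfiable \<open>THE\<close>.\<close>

definition iv :: "int \<Rightarrow> int"
  where "iv x = int (fp_inv p (nat (x mod int p)))"

definition periodic :: "(int \<Rightarrow> 'a) \<Rightarrow> bool"
  where "periodic g \<longleftrightarrow> (\<forall>x. g (x mod int p) = g x)"

lemma p_gt_1: "1 < p"
  using prime_p prime_gt_1_nat by blast

lemma p_pos [simp]: "0 < p"
  using p_gt_1 by simp

lemma prime_int_p: "prime (int p)"
  using prime_p by simp

lemma finite_R [simp]: "finite R" and finite_U [simp]: "finite U"
  by (simp_all add: R_def U_def)

lemma card_R [simp]: "card R = p" and card_U: "card U = p - 1"
  by (simp_all add: R_def U_def)

lemma mod_in_R [simp]: "x mod int p \<in> R"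
  by (simp add: R_def)

lemma mod_R: "x \<in> R \<Longrightarrow> x mod int p = x"
  by (simp add: R_def)

lemma U_iff: "x \<in> U \<longleftrightarrow> x \<in> R \<and> \<not> x \<doteq> 0"
  using zdvd_imp_le[of "int p" x] by (cases "x = 0") (auto simp: R_def U_def cong_0_iff)

lemma U_subset_R: "U \<subseteq> R"
  by (auto simp: U_iff)

lemma R_insert_U: "R = insert 0 U" and zero_notin_U [simp]: "0 \<notin> U"
  by (auto simp: R_def U_def)

lemma mod_cong: "x mod int p \<doteq> x"
  by (simp add: cong_def)

lemma cong_R_eq: "x \<in> R \<Longrightarrow> y \<in> R \<Longrightarrow> x \<doteq> y \<longleftrightarrow> x = y"
  by (simp add: cong_def mod_R)

lemma cong_dvd: "a \<doteq> b \<longleftrightarrow> int p dvd a - b"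
  by (rule cong_iff_dvd_diff)

lemma diff_cong_0_iff: "a - b \<doteq> 0 \<longleftrightarrow> a \<doteq> b"
  by (simp add: cong_dvd)

lemma cong_diff_self_iff: "a \<doteq> a - b \<longleftrightarrow> b \<doteq> 0"
  by (simp add: cong_dvd)

lemma mult_zero_iff: "a * b \<doteq> 0 \<longleftrightarrow> a \<doteq> 0 \<or> b \<doteq> 0"
  using prime_int_p by (simp add: cong_0_iff prime_dvd_mult_iff)

lemma mult_lcancel: "\<not> c \<doteq> 0 \<Longrightarrow> c * a \<doteq> c * b \<longleftrightarrow> a \<doteq> b"
  using mult_zero_iff[of c "a - b"] by (simp add: cong_dvd right_diff_distrib)

text \<open>The \<open>THE\<close> in \<open>fp_inv\<close> is resolved here: a Bezout coefficient
  gives existence, cancellation of a unit gives uniqueness.\<close>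

lemma iv_range:
  assumes "\<not> x \<doteq> 0"
  shows "iv x \<in> R" and iv_right: "x * iv x \<doteq> 1"
proof -
  define y where "y = nat (x mod int p)"
  have y: "int y = x mod int p" by (simp add: y_def)
  have cop: "coprime (int y) (int p)"
    using assms prime_int_p by (metis y cong_0_iff cong_mod_left coprime_commute prime_imp_coprime cong_def dvd_eq_mod_eq_0 mod_mod_trivial)
  then obtain w where w: "int y * w \<doteq> 1" using cong_solve_coprime_int by blast
  define z where "z = nat (w mod int p)"
  have z: "int z = w mod int p" by (simp add: z_def)
  have "int y * int z \<doteq> 1" using w by (simp add: z cong_def mod_mult_right_eq)
  then have "int (y * z mod p) = int 1"
    using p_gt_1 by (simp add: cong_def zmod_int)
  then have 1: "z < p \<and> (y * z) mod p = 1"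
    unfolding of_nat_eq_iff using p_gt_1 by (simp add: z_def nat_less_iff)
  have uniq: "z' = z" if "z' < p \<and> (y * z') mod p = 1" for z'
  proof -
    have "[y * z' = y * z] (mod p)" using that 1 by (simp add: cong_def)
    then have "[z' = z] (mod p)" using cop by (simp add: cong_mult_lcancel_nat)
    then show ?thesis using that 1 by (simp add: cong_def)
  qed
  have "fp_inv p y = z" unfolding fp_inv_def using 1 uniq by (rule the_equality)
  then have iv: "iv x = int z" by (simp add: iv_def y_def)
  then show "iv x \<in> R" by (simp add: z)
  show "x * iv x \<doteq> 1"
    using \<open>int y * int z \<doteq> 1\<close> by (simp add: iv y cong_def mod_mult_left_eq)
qed

lemma iv_not_zero: "\<not> x \<doteq> 0 \<Longrightarrow> \<not> iv x \<doteq> 0"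
  using iv_right[of x] p_gt_1 by (metis cong_0_iff cong_sym cong_trans mult_zero_iff not_prime_unit prime_int_p cong_dvd_iff)

lemma iv_mod: "iv (x mod int p) = iv x"
  by (simp add: iv_def)

section \<open>Sums of periodic functions over the residues\<close>

lemma sum_shift:
  fixes g :: "int \<Rightarrow> 'a::comm_monoid_add"
  assumes "periodic g"
  shows "(\<Sum>x\<in>R. g (x + a)) = (\<Sum>x\<in>R. g x)"
proof (rule sum.reindex_bij_witness[of R "\<lambda>x. (x - a) mod int p" "\<lambda>x. (x + a) mod int p"])
qed (use assms in \<open>auto simp: periodic_def mod_R mod_diff_left_eq mod_add_left_eq\<close>)

lemma sum_reflect:
  fixes g :: "int \<Rightarrow> 'a::comm_monoid_add"
  assumes "periodic g"
  shows "(\<Sum>x\<in>R. g (a - x)) = (\<Sum>x\<in>R. g x)"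
proof (rule sum.reindex_bij_witness[of R "\<lambda>x. (a - x) mod int p" "\<lambda>x. (a - x) mod int p"])
qed (use assms in \<open>auto simp: periodic_def mod_R mod_diff_right_eq\<close>)

lemma periodic_cong: "periodic g \<Longrightarrow> x \<doteq> y \<Longrightarrow> g x = g y"
  by (metis periodic_def cong_def)

lemma periodicI: "(\<And>x y. x \<doteq> y \<Longrightarrow> g x = g y) \<Longrightarrow> periodic g"
  by (simp add: periodic_def)

lemma periodicD: "periodic g \<Longrightarrow> g (x mod int p) = g x"
  by (simp add: periodic_def)

lemma periodic_comp: "periodic f \<Longrightarrow> periodic g \<Longrightarrow> periodic (\<lambda>x. h (f x) (g x))"
  by (simp add: periodic_def)

lemma periodic_add: "periodic g \<Longrightarrow> periodic (\<lambda>x. g (x + a))"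
  by (rule periodicI) (simp add: periodic_cong cong_add)

lemma periodic_diff: "periodic g \<Longrightarrow> periodic (\<lambda>x. g (x - a))"
  by (rule periodicI) (simp add: periodic_cong cong_diff)

lemma iv_resp: "x \<doteq> y \<Longrightarrow> iv x = iv y"
  by (metis iv_mod cong_def)

section \<open>Additive characters, orthogonality, and congruences with inverses\<close>

lemma ech_add: "ech (a + b) = ech a * ech b"
  by (simp add: ech_def cis_mult add_divide_distrib ring_distribs)

lemma ech_0 [simp]: "ech 0 = 1"
  by (simp add: ech_def)

lemma norm_ech [simp]: "cmod (ech a) = 1"
  by (simp add: ech_def)

lemma ech_uminus: "ech (- a) = cnj (ech a)"
  by (simp add: ech_def cis_cnj)

lemma ech_diff: "ech (a - b) = ech a * cnj (ech b)"
  using ech_add[of a "-b"] by (simp add: ech_uminus)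

lemma ech_eq_1_iff: "ech a = 1 \<longleftrightarrow> a \<doteq> 0"
proof
  assume "ech a = 1"
  then have "cos (2 * pi * of_int a / of_nat p) = 1"
    by (metis ech_def cis.simps(1) one_complex.simps(1))
  then obtain n :: int where "2 * pi * of_int a / of_nat p = of_int n * 2 * pi"
    using cos_one_2pi_int by blast
  then have "real_of_int a = real_of_int (n * int p)" by (simp add: field_simps)
  then show "a \<doteq> 0" by (simp add: cong_0_iff del: of_int_mult)
next
  assume "a \<doteq> 0"
  then obtain n where "a = int p * n" by (auto simp: cong_0_iff)
  then have "2 * pi * of_int a / of_nat p = 2 * pi * of_int n" using p_gt_1 by simp
  then show "ech a = 1" unfolding ech_def by (simp add: cis_multiple_2pi)
qed

lemma ech_cong: "a \<doteq> b \<Longrightarrow> ech a = ech b"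
  using ech_eq_1_iff[of "a - b"] ech_add[of "a - b" b] by (simp add: cong_dvd)

text \<open>Replacing \<open>x\<close> by \<open>x + 1\<close> permutes the residues and multiplies
  the sum by \<open>ech a\<close>, which differs from 1 unless \<open>a\<close> vanishes.\<close>

lemma sum_ech: "(\<Sum>x\<in>R. ech (x * a)) = (if a \<doteq> 0 then of_nat p else 0)"
proof (cases "a \<doteq> 0")
  case True
  then have "ech (x * a) = 1" for x by (simp add: ech_eq_1_iff cong_0_iff)
  then show ?thesis using True by simp
next
  case False
  have "periodic (\<lambda>x. ech (x * a))"
    by (intro periodicI ech_cong cong_scalar_right)
  from sum_shift[OF this, of 1] have "(\<Sum>x\<in>R. ech (x * a)) * ech a = (\<Sum>x\<in>R. ech (x * a))"
    by (simp add: sum_distrib_right ring_distribs ech_add)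
  then show ?thesis using False ech_eq_1_iff[of a] by simp
qed

text \<open>Lets a congruence be proved by a certificate: its difference is displayed as a
  combination of differences already known to be divisible, and only a polynomial identity is left
  to check.\<close>

lemma dvd_combine:
  "G = u * a + v * b \<Longrightarrow> int p dvd a \<Longrightarrow> int p dvd b \<Longrightarrow> int p dvd G"
  by simp

lemma iv_cong: "\<not> x \<doteq> 0 \<Longrightarrow> x * y \<doteq> 1 \<Longrightarrow> iv x \<doteq> y"
  using mult_lcancel[of x "iv x" y] iv_right[of x] cong_trans cong_sym by blast

lemma sq_cong_iff: "w * w \<doteq> v * v \<longleftrightarrow> w \<doteq> v \<or> w \<doteq> - v"
proof -
  have "w * w - v * v = (w - v) * (w - - v)" by (simp add: algebra_simps)
  then show ?thesis using mult_zero_iff[of "w - v" "w - - v"] by (simp add: cong_dvd)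
qed

text \<open>Clearing denominators in y - 1/y = z - 1/z gives (y - z)(yz + 1) = 0. This controls the
  fibres that occur in \<open>sum_diag_le\<close>.\<close>

lemma sub_iv_fibre:
  assumes "\<not> y \<doteq> 0" "\<not> z \<doteq> 0" "y - iv y \<doteq> z - iv z"
  shows "z \<doteq> y \<or> z \<doteq> - iv y"
proof -
  have "int p dvd (y - z) * (y * z + 1)"
  proof (rule dvd_combine)
    show "(y - z) * (y * z + 1) =
        (y * z) * ((y - iv y) - (z - iv z)) + 1 * (z * (y * iv y - 1) - y * (z * iv z - 1))"
      by (simp add: algebra_simps)
  qed (use assms iv_right[of y] iv_right[of z] in \<open>auto simp: cong_dvd\<close>)
  then consider "y - z \<doteq> 0" | "y * z + 1 \<doteq> 0"
    using mult_zero_iff[of "y - z" "y * z + 1"] by (auto simp: cong_0_iff)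
  then show ?thesis
  proof cases
    case 1
    then show ?thesis by (simp add: cong_dvd dvd_diff_commute)
  next
    case 2
    then have "y * (- z) \<doteq> 1"
      using dvd_minus_iff[of "int p" "y * z + 1"] by (simp add: cong_dvd)
    from iv_cong[OF assms(1) this] have "z \<doteq> - iv y"
      using dvd_minus_iff[of "int p" "iv y - (- z)"] by (simp add: cong_dvd add.commute)
    then show ?thesis ..
  qed
qed

lemma iv_diff_cong:
  assumes "\<not> y \<doteq> 0" "\<not> y - d \<doteq> 0"
  shows "(y * (y - d)) * (iv y - iv (y - d)) \<doteq> - d"
  unfolding cong_dvd
proof (rule dvd_combine)
  show "(y * (y - d)) * (iv y - iv (y - d)) - - d
      = (y - d) * (y * iv y - 1) + (- y) * ((y - d) * iv (y - d) - 1)"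
    by (simp add: algebra_simps)
qed (use assms iv_right[of y] iv_right[of "y - d"] in \<open>auto simp: cong_dvd\<close>)

text \<open>Since 1/y - 1/(y - d) = -d / (y (y - d)), equality of the two distances becomes the
  equation of a conic in y and z.\<close>

lemma iv_diff_eq_iff:
  assumes "\<not> y \<doteq> 0" "\<not> y - d \<doteq> 0" "\<not> z \<doteq> 0" "\<not> z - e \<doteq> 0"
  shows "iv y - iv (y - d) \<doteq> iv z - iv (z - e) \<longleftrightarrow> d * (z * (z - e)) \<doteq> e * (y * (y - d))"
    (is "?X \<doteq> ?Z \<longleftrightarrow> d * ?v \<doteq> e * ?u")
proof -
  have "\<not> ?u * ?v \<doteq> 0" using assms by (simp add: mult_zero_iff)
  from mult_lcancel[OF this] have "?X \<doteq> ?Z \<longleftrightarrow> (?u * ?v) * ?X \<doteq> (?u * ?v) * ?Z" by blast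
  moreover have "(?u * ?v) * ?X \<doteq> - (d * ?v)"
    using cong_scalar_left[OF iv_diff_cong[OF assms(1,2)], of ?v] by (simp add: mult_ac)
  moreover have "(?u * ?v) * ?Z \<doteq> - (e * ?u)"
    using cong_scalar_left[OF iv_diff_cong[OF assms(3,4)], of ?u] by (simp add: mult_ac)
  ultimately have "?X \<doteq> ?Z \<longleftrightarrow> - (d * ?v) \<doteq> - (e * ?u)"
    by (meson cong_sym cong_trans)
  then show ?thesis by (simp add: cong_minus_minus_iff)
qed

subsection \<open>The conic\<close>

text \<open>The point of the conic \<open>d z (z - e) = e y (y - d)\<close> with \<open>d z / y = w\<close>.\<close>

definition conic_y :: "int \<Rightarrow> int \<Rightarrow> int \<Rightarrow> int"
  where "conic_y d e w = (d * e) * (w - d) * iv (w * w - d * e)"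

definition conic_z :: "int \<Rightarrow> int \<Rightarrow> int \<Rightarrow> int"
  where "conic_z d e w = e * w * (w - d) * iv (w * w - d * e)"

context
  fixes d e w :: int
  assumes nz: "\<not> d \<doteq> 0" "\<not> e \<doteq> 0" "\<not> w \<doteq> 0" "\<not> w \<doteq> d" "\<not> w \<doteq> e" "\<not> w * w \<doteq> d * e"
begin

private abbreviation "D \<equiv> w * w - d * e"

lemma conic_D: "\<not> D \<doteq> 0" "D * iv D \<doteq> 1" "\<not> iv D \<doteq> 0"
  using nz iv_right[of D] iv_not_zero[of D] by (auto simp: cong_dvd)

lemma conic_y_minus: "conic_y d e w - d \<doteq> iv D * d * w * (e - w)"
  unfolding cong_dvd conic_y_def
proof (rule dvd_combine)
  show "d * e * (w - d) * iv D - d - iv D * d * w * (e - w) = d * (D * iv D - 1) + 0 * (D * iv D - 1)"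
    by (simp add: algebra_simps)
qed (use conic_D in \<open>auto simp: cong_dvd\<close>)

lemma conic_z_minus: "conic_z d e w - e \<doteq> iv D * (d * e) * (e - w)"
  unfolding cong_dvd conic_z_def
proof (rule dvd_combine)
  show "e * w * (w - d) * iv D - e - iv D * (d * e) * (e - w) = e * (D * iv D - 1) + 0 * (D * iv D - 1)"
    by (simp add: algebra_simps)
qed (use conic_D in \<open>auto simp: cong_dvd\<close>)

text \<open>The four quantities factor completely, and their zeros are among the excluded slopes:
  \<open>w = d\<close> kills y and z, \<open>w = e\<close> gives y = d and z = e, and
  \<open>w = 0\<close> gives z = 0 and y = d.\<close>

lemma conic_nonzero:
  "\<not> conic_y d e w \<doteq> 0" "\<not> conic_z d e w \<doteq> 0"
  "\<not> conic_y d e w - d \<doteq> 0" "\<not> conic_z d e w - e \<doteq> 0"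
proof -
  have "\<not> w - d \<doteq> 0" "\<not> e - w \<doteq> 0" using nz by (auto simp: cong_dvd dvd_diff_commute)
  then have "\<not> iv D * d * w * (e - w) \<doteq> 0" "\<not> iv D * (d * e) * (e - w) \<doteq> 0"
    "\<not> conic_y d e w \<doteq> 0" "\<not> conic_z d e w \<doteq> 0"
    using nz conic_D by (auto simp: mult_zero_iff conic_y_def conic_z_def)
  then show "\<not> conic_y d e w \<doteq> 0" "\<not> conic_z d e w \<doteq> 0"
    "\<not> conic_y d e w - d \<doteq> 0" "\<not> conic_z d e w - e \<doteq> 0"
    using conic_y_minus conic_z_minus cong_trans cong_sym by blast+
qed

lemma conic_on:
  "d * (conic_z d e w * (conic_z d e w - e)) \<doteq> e * (conic_y d e w * (conic_y d e w - d))"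
proof -
  have "d * (conic_z d e w * (conic_z d e w - e)) \<doteq> d * (conic_z d e w * (iv D * (d * e) * (e - w)))"
    by (intro cong_mult cong_refl conic_z_minus)
  also have "d * (conic_z d e w * (iv D * (d * e) * (e - w))) = e * (conic_y d e w * (iv D * d * w * (e - w)))"
    by (simp add: conic_y_def conic_z_def)
  also have "\<dots> \<doteq> e * (conic_y d e w * (conic_y d e w - d))"
    by (intro cong_mult cong_refl cong_sym[OF conic_y_minus])
  finally show ?thesis .
qed

lemma conic_slope: "w * conic_y d e w = d * conic_z d e w"
  by (simp add: conic_y_def conic_z_def)

text \<open>Multiplication by the unit \<open>?m * w * ?y * ?z\<close> clears all inverses. Both
  sides then equal \<open>?m * w * (?z - ?y)\<close>, by the formula for y and the slope relation
  \<open>w * ?y = d * ?z\<close>.\<close>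

lemma conic_phase_iv: "iv (conic_y d e w) - iv (conic_z d e w) \<doteq> w * iv (d * e) - iv w"
proof -
  let ?y = "conic_y d e w" and ?z = "conic_z d e w" and ?m = "d * e"
  have m: "\<not> ?m \<doteq> 0" using nz by (simp add: mult_zero_iff)
  have 1: "?m * (w - d) \<doteq> ?y * D"
    using cong_scalar_left[OF cong_sym[OF conic_D(2)], of "?m * (w - d)"]
    by (simp add: conic_y_def mult_ac)
  have iy: "?y * iv ?y \<doteq> 1" and iz: "?z * iv ?z \<doteq> 1" and iw: "w * iv w \<doteq> 1" and im: "?m * iv ?m \<doteq> 1"
    using iv_right conic_nonzero nz m by auto
  have "\<not> ?m * w * ?y * ?z \<doteq> 0" using m nz conic_nonzero by (simp add: mult_zero_iff)
  moreover have "(?m * w * ?y * ?z) * (iv ?y - iv ?z) \<doteq> ?m * w * (?z - ?y)"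
    unfolding cong_dvd
  proof (rule dvd_combine)
    show "(?m * w * ?y * ?z) * (iv ?y - iv ?z) - ?m * w * (?z - ?y)
       = (?m * w * ?z) * (?y * iv ?y - 1) + (- ?m * w * ?y) * (?z * iv ?z - 1)"
      by (simp add: algebra_simps)
  qed (use iy iz in \<open>auto simp: cong_dvd\<close>)
  moreover have "(?m * w * ?y * ?z) * (w * iv ?m - iv w) \<doteq> ?y * ?z * D"
    unfolding cong_dvd
  proof (rule dvd_combine)
    show "(?m * w * ?y * ?z) * (w * iv ?m - iv w) - ?y * ?z * D
       = (w * w * ?y * ?z) * (?m * iv ?m - 1) + (- ?m * ?y * ?z) * (w * iv w - 1)"
      by (simp add: algebra_simps)
  qed (use iw im in \<open>auto simp: cong_dvd\<close>)
  moreover have "?y * ?z * D \<doteq> ?m * w * (?z - ?y)"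
  proof -
    have "?z * (?y * D) \<doteq> ?z * (?m * (w - d))" by (intro cong_mult cong_refl cong_sym[OF 1])
    moreover have "?z * (?m * (w - d)) = ?m * w * (?z - ?y)"
    proof -
      have "?z * (?m * (w - d)) = ?m * w * ?z - ?m * (d * ?z)" by (simp add: algebra_simps)
      then show ?thesis unfolding conic_slope[symmetric] by (simp add: algebra_simps)
    qed
    ultimately show ?thesis by (metis mult.assoc mult.commute)
  qed
  ultimately show ?thesis
    by (meson mult_lcancel cong_sym cong_trans)
qed

text \<open>The grouping matters: apart from \<open>- e\<close>, which leaves the sum over
  \<open>w\<close> as a unimodular factor, \<open>d\<close> and \<open>e\<close> enter only through
  their product and their sum, and the sum enters linearly.\<close>

lemma conic_phase_diff:
  "conic_y d e w - conic_z d e w \<doteq> - e - (d * e) * (d + e) * iv D + 2 * (d * e) * w * iv D"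
  unfolding cong_dvd conic_y_def conic_z_def
proof (rule dvd_combine)
  show "(d * e) * (w - d) * iv D - e * w * (w - d) * iv D - (- e - (d * e) * (d + e) * iv D + 2 * (d * e) * w * iv D)
     = (- e) * (D * iv D - 1) + 0 * (D * iv D - 1)"
    by (simp add: algebra_simps)
qed (use conic_D in \<open>auto simp: cong_dvd\<close>)

end

text \<open>Once dz = wy is substituted, the conic has the known factor y, and what remains is
  linear in y. So the slope determines the point, and the parametrisation reaches every admissible
  point.\<close>

lemma conic_inverse:
  assumes nz: "\<not> d \<doteq> 0" "\<not> e \<doteq> 0" "\<not> d \<doteq> e" "\<not> y \<doteq> 0" "\<not> z \<doteq> 0" "\<not> y - d \<doteq> 0" "\<not> z - e \<doteq> 0"
    and conic: "d * (z * (z - e)) \<doteq> e * (y * (y - d))"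
    and w: "w \<doteq> d * z * iv y"
  shows "\<not> w \<doteq> 0" "\<not> w \<doteq> d" "\<not> w \<doteq> e" "\<not> w * w \<doteq> d * e"
    "conic_y d e w \<doteq> y" "conic_z d e w \<doteq> z"
proof -
  have wy: "w * y \<doteq> d * z"
  proof -
    have "w * y \<doteq> (d * z * iv y) * y" by (intro cong_mult cong_refl w)
    also have "(d * z * iv y) * y = d * z * (y * iv y)" by simp
    also have "\<dots> \<doteq> d * z * 1" by (intro cong_mult cong_refl iv_right nz)
    finally show ?thesis by simp
  qed
  show "\<not> w \<doteq> 0" using wy nz by (metis mult_zero_iff cong_sym cong_trans)
  have wy': "int p dvd w * y - d * z" and conic': "int p dvd d * (z * (z - e)) - e * (y * (y - d))"
    using wy conic by (simp_all add: cong_dvd)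
  show "\<not> w \<doteq> d"
  proof
    assume "w \<doteq> d"
    have "int p dvd d * y - d * z"
      by (rule dvd_combine[of _ 1 "w * y - d * z" "- y" "w - d"])
        (use wy' \<open>w \<doteq> d\<close> in \<open>simp_all add: cong_dvd algebra_simps\<close>)
    then have "y \<doteq> z" using mult_lcancel[OF nz(1), of y z] by (simp add: cong_dvd)
    \<comment> \<open>With y = z the conic collapses to y^2 (d - e) = 0.\<close>
    have "int p dvd y * y * (d - e)"
      by (rule dvd_combine[OF _ conic', of _ 1 "d * (y + z - e)" "y - z"])
        (use \<open>y \<doteq> z\<close> in \<open>simp_all add: cong_dvd algebra_simps\<close>)
    then have "y * y * (d - e) \<doteq> 0" by (simp add: cong_dvd)
    then show False using nz by (simp add: mult_zero_iff) (simp add: cong_dvd)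
  qed
  show "\<not> w \<doteq> e"
  proof
    assume "w \<doteq> e"
    have 1: "int p dvd e * y - d * z"
      by (rule dvd_combine[of _ 1 "w * y - d * z" "- y" "w - e"])
        (use wy' \<open>w \<doteq> e\<close> in \<open>simp_all add: cong_dvd algebra_simps\<close>)
    \<comment> \<open>By \<open>1\<close> the right side of the conic is d z (y - d), so d z
      cancels. Together with \<open>1\<close> this gives (e - d)(y - d) = 0.\<close>
    have "int p dvd d * z * (z - e - y + d)"
      by (rule dvd_combine[OF _ conic' 1, of _ 1 "y - d"]) (simp add: algebra_simps)
    then have "d * z * (z - e - y + d) \<doteq> 0" by (simp add: cong_dvd)
    then have 2: "int p dvd z - e - y + d" using nz by (simp add: mult_zero_iff) (simp add: cong_dvd)
    have "int p dvd (e - d) * (y - d)"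
      by (rule dvd_combine[OF _ 2 1, of _ d 1]) (simp add: algebra_simps)
    then have "(e - d) * (y - d) \<doteq> 0" by (simp add: cong_dvd)
    then show False using nz by (simp add: mult_zero_iff) (simp add: cong_dvd dvd_diff_commute)
  qed
  then have wd: "\<not> w - d \<doteq> 0" using \<open>\<not> w \<doteq> d\<close> by (simp add: cong_dvd)
  \<comment> \<open>This is \<open>d\<close> times the conic with \<open>d * z\<close> replaced by
    \<open>w * y\<close>; cancelling y leaves the equation that defines
    \<open>conic_y\<close>.\<close>
  have "int p dvd y * (y * (w * w - d * e) - (d * e) * (w - d))"
    by (rule dvd_combine[OF _ conic' wy', of _ d "w * y + d * z - d * e"]) (simp add: algebra_simps)
  then have "y * (y * (w * w - d * e) - (d * e) * (w - d)) \<doteq> 0" by (simp add: cong_dvd)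
  then have key: "int p dvd y * (w * w - d * e) - (d * e) * (w - d)"
    using nz by (simp add: mult_zero_iff) (simp add: cong_dvd)
  show D: "\<not> w * w \<doteq> d * e"
  proof
    assume "w * w \<doteq> d * e"
    then have "int p dvd d * e * (w - d)"
      by (intro dvd_combine[OF _ key, of "d * e * (w - d)" "- 1" y "w * w - d * e"]) (simp_all add: cong_dvd)
    then have "d * e * (w - d) \<doteq> 0" by (simp add: cong_dvd)
    then show False using nz wd by (simp add: mult_zero_iff)
  qed
  show y: "conic_y d e w \<doteq> y"
    unfolding cong_dvd conic_y_def
  proof (rule dvd_combine[OF _ key])
    show "d * e * (w - d) * iv (w * w - d * e) - y = - iv (w * w - d * e) * (y * (w * w - d * e) - d * e * (w - d))
      + y * ((w * w - d * e) * iv (w * w - d * e) - 1)"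
      by (simp add: algebra_simps)
    show "int p dvd (w * w - d * e) * iv (w * w - d * e) - 1"
      using iv_right[of "w * w - d * e"] D by (simp add: cong_dvd)
  qed
  have "d * conic_z d e w = w * conic_y d e w" by (simp add: conic_y_def conic_z_def)
  also have "\<dots> \<doteq> w * y" by (intro cong_mult cong_refl y)
  also note wy
  finally show "conic_z d e w \<doteq> z" using mult_lcancel nz by blast
qed

subsection \<open>Mean square of the Gram matrix\<close>

definition gram_pairs :: "int \<Rightarrow> int \<Rightarrow> (int \<times> int) set"
  where "gram_pairs d e = {(y, z). y \<in> U \<and> \<not> y - d \<doteq> 0 \<and> z \<in> U \<and> \<not> z - e \<doteq> 0 \<and>
    iv y - iv (y - d) \<doteq> iv z - iv (z - e)}"

text \<open>The Gram entries that \<open>norm_bilinear_sum_le\<close> produces for the bilinear form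
  \<open>freq_form\<close>.\<close>

definition gram :: "int \<Rightarrow> int \<Rightarrow> int \<Rightarrow> complex"
  where "gram \<xi> d e = (\<Sum>(y, z)\<in>gram_pairs d e. ech (- \<xi> * (y - iv y)) * cnj (ech (- \<xi> * (z - iv z))))"

definition slopes :: "int \<Rightarrow> int set"
  where "slopes m = {w \<in> U. \<not> w * w \<doteq> m}"

text \<open>On the conic, with m = de and s = d + e, the phase (1/y - 1/z) - (y - z) equals e plus
  this expression.\<close>

definition slope_phase :: "int \<Rightarrow> int \<Rightarrow> int \<Rightarrow> int"
  where "slope_phase m s w = m * s * iv (w * w - m) - 2 * m * w * iv (w * w - m) + w * iv m - iv w"

text \<open>The slopes \<open>d\<close> and \<open>e\<close> are kept, so that the sum depends on
  \<open>m\<close> and \<open>s\<close> alone and \<open>s\<close> can vary freely for fixed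
  \<open>m\<close>.\<close>

definition slope_sum :: "int \<Rightarrow> int \<Rightarrow> int \<Rightarrow> complex"
  where "slope_sum \<xi> m s = (\<Sum>w\<in>slopes m. ech (\<xi> * slope_phase m s w))"

lemma finite_slopes [simp]: "finite (slopes m)"
  by (simp add: slopes_def)

lemma card_slopes_le: "card (slopes m) \<le> p"
proof -
  have "card (slopes m) \<le> card R" by (rule card_mono) (auto simp: slopes_def U_iff)
  then show ?thesis by simp
qed

lemma gram_pairs_iff:
  assumes "d \<in> U" "e \<in> U"
  shows "(y, z) \<in> gram_pairs d e \<longleftrightarrow> y \<in> U \<and> \<not> y - d \<doteq> 0 \<and> z \<in> U \<and> \<not> z - e \<doteq> 0 \<and>
    d * (z * (z - e)) \<doteq> e * (y * (y - d))"
  using iv_diff_eq_iff[of y d z e] by (auto simp: gram_pairs_def U_iff)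

text \<open>Reindexing by the slope, with \<open>conic_y\<close>, \<open>conic_z\<close> and
  \<open>conic_inverse\<close> as mutually inverse maps. For \<open>d = e\<close> the conic splits
  into two lines, so the diagonal is treated apart in \<open>norm_gram_diag\<close>.\<close>

lemma gram_eq_slope_sum:
  assumes "d \<in> U" "e \<in> U" "d \<noteq> e"
  shows "gram \<xi> d e = ech (\<xi> * e) * (\<Sum>w\<in>slopes (d * e) - {d, e}. ech (\<xi> * slope_phase (d * e) (d + e) w))"
  unfolding gram_def sum_distrib_left
proof (rule sum.reindex_bij_witness[of _
      "\<lambda>w. (conic_y d e w mod int p, conic_z d e w mod int p)" "\<lambda>(y, z). (d * z * iv y) mod int p"])
  have de: "\<not> d \<doteq> 0" "\<not> e \<doteq> 0" "\<not> d \<doteq> e" "d \<in> R" "e \<in> R"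
    using assms by (auto simp: U_iff cong_R_eq)
  have w: "w \<in> R" "\<not> w \<doteq> 0" "\<not> w \<doteq> d" "\<not> w \<doteq> e" "\<not> w * w \<doteq> d * e"
    if "w \<in> slopes (d * e) - {d, e}" for w
    using that assms by (auto simp: slopes_def U_iff cong_R_eq)
  have phase: "ech (- \<xi> * (y - iv y)) * cnj (ech (- \<xi> * (z - iv z))) = ech (\<xi> * e) * ech (\<xi> * slope_phase (d * e) (d + e) w)"
    if w: "\<not> w \<doteq> 0" "\<not> w \<doteq> d" "\<not> w \<doteq> e" "\<not> w * w \<doteq> d * e"
      and y: "y \<doteq> conic_y d e w" and z: "z \<doteq> conic_z d e w" for y z w
  proof -
    note con = conic_phase_diff[OF de(1,2) w] conic_phase_iv[OF de(1,2) w]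
    have yz: "y - z \<doteq> conic_y d e w - conic_z d e w" "iv y = iv (conic_y d e w)" "iv z = iv (conic_z d e w)"
      using y z by (auto intro: cong_diff iv_resp)
    have "- \<xi> * (y - iv y) - (- \<xi> * (z - iv z)) = - \<xi> * ((y - z) - (iv y - iv z))"
      by (simp add: algebra_simps)
    also have "- \<xi> * ((y - z) - (iv y - iv z)) \<doteq> - \<xi> * ((- e - (d * e) * (d + e) * iv (w * w - d * e)
        + 2 * (d * e) * w * iv (w * w - d * e)) - (w * iv (d * e) - iv w))"
      unfolding yz(2,3) by (intro cong_mult[OF cong_refl] cong_diff[OF cong_trans[OF yz(1) con(1)] con(2)])
    also have "- \<xi> * ((- e - (d * e) * (d + e) * iv (w * w - d * e)
        + 2 * (d * e) * w * iv (w * w - d * e)) - (w * iv (d * e) - iv w)) = \<xi> * e + \<xi> * slope_phase (d * e) (d + e) w"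
      by (simp add: slope_phase_def algebra_simps)
    finally have "ech (- \<xi> * (y - iv y) - (- \<xi> * (z - iv z))) = ech (\<xi> * e + \<xi> * slope_phase (d * e) (d + e) w)"
      by (rule ech_cong)
    then show ?thesis by (simp only: ech_diff ech_add)
  qed
  {
    fix w assume "w \<in> slopes (d * e) - {d, e}"
    note w = w[OF this]
    note con = conic_nonzero[OF de(1,2) w(2-)] conic_on[OF de(1,2) w(2-)]
    let ?y = "conic_y d e w" and ?z = "conic_z d e w"
    have "d * (?z mod int p) * iv (?y mod int p) \<doteq> d * ?z * iv ?y"
      by (intro cong_mult cong_refl mod_cong) (simp add: iv_mod)
    also have "d * ?z * iv ?y = w * (?y * iv ?y)" using conic_slope[OF de(1,2) w(2-)] by simp
    also have "\<dots> \<doteq> w * 1" by (intro cong_mult cong_refl iv_right con)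
    finally show "(case (?y mod int p, ?z mod int p) of (y, z) \<Rightarrow> d * z * iv y mod int p) = w"
      using w(1) by (simp add: cong_def mod_R)
    have "d * ((?z mod int p) * (?z mod int p - e)) \<doteq> d * (?z * (?z - e))"
      by (intro cong_mult cong_diff cong_refl mod_cong)
    also note con(5)
    also have "e * (?y * (?y - d)) \<doteq> e * ((?y mod int p) * (?y mod int p - d))"
      by (intro cong_mult cong_diff cong_refl cong_sym[OF mod_cong])
    finally have "d * ((?z mod int p) * (?z mod int p - e)) \<doteq> e * ((?y mod int p) * (?y mod int p - d))" .
    moreover have "?y mod int p \<in> U" "?z mod int p \<in> U" "\<not> ?y mod int p - d \<doteq> 0" "\<not> ?z mod int p - e \<doteq> 0"
      using con(1-4) by (auto simp: U_iff cong_def mod_diff_left_eq)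
    ultimately show "(?y mod int p, ?z mod int p) \<in> gram_pairs d e"
      using assms by (simp add: gram_pairs_iff)
  next
    fix b assume b: "b \<in> gram_pairs d e"
    obtain y z where yz: "b = (y, z)" by (cases b)
    let ?w = "d * z * iv y mod int p"
    have vs: "y \<in> R" "z \<in> R" "\<not> y \<doteq> 0" "\<not> z \<doteq> 0" "\<not> y - d \<doteq> 0" "\<not> z - e \<doteq> 0"
      "d * (z * (z - e)) \<doteq> e * (y * (y - d))"
      using b assms by (auto simp: yz gram_pairs_iff U_iff)
    note inv = conic_inverse[OF de(1-3) vs(3-7) mod_cong]
    show "(conic_y d e (case b of (y, z) \<Rightarrow> d * z * iv y mod int p) mod int p,
           conic_z d e (case b of (y, z) \<Rightarrow> d * z * iv y mod int p) mod int p) = b"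
      using inv(5,6) vs(1,2) by (simp add: yz cong_def mod_R)
    show "(case b of (y, z) \<Rightarrow> d * z * iv y mod int p) \<in> slopes (d * e) - {d, e}"
    proof -
      have "?w \<noteq> d" "?w \<noteq> e" using inv(2,3) cong_refl by metis+
      then show ?thesis using inv(1,4) by (simp add: yz slopes_def U_iff)
    qed
    show "ech (\<xi> * e) * ech (\<xi> * slope_phase (d * e) (d + e) (case b of (y, z) \<Rightarrow> d * z * iv y mod int p)) =
      (case b of (y, z) \<Rightarrow> ech (- \<xi> * (y - iv y)) * cnj (ech (- \<xi> * (z - iv z))))"
      unfolding yz prod.case by (rule phase[symmetric]) (use inv cong_sym in auto)
  }
qed

text \<open>A large sieve over a full period: after the square is expanded, orthogonality in
  \<open>s\<close> keeps only the pairs whose frequencies \<open>h\<close> agree, at most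
  \<open>k\<close> for each \<open>w\<close>.\<close>

lemma sum_norm_sq_le:
  assumes A: "finite A" and c: "\<And>w. w \<in> A \<Longrightarrow> cmod (c w) \<le> 1"
    and k: "\<And>w. w \<in> A \<Longrightarrow> card {v \<in> A. h w \<doteq> h v} \<le> k"
  shows "(\<Sum>s\<in>R. (cmod (\<Sum>w\<in>A. c w * ech (s * h w)))\<^sup>2) \<le> real p * (k * card A)"
proof -
  have "of_real (\<Sum>s\<in>R. (cmod (\<Sum>w\<in>A. c w * ech (s * h w)))\<^sup>2)
     = (\<Sum>s\<in>R. \<Sum>w\<in>A. \<Sum>v\<in>A. c w * ech (s * h w) * cnj (c v * ech (s * h v)))"
    unfolding of_real_sum norm_sum_sq ..
  also have "\<dots> = (\<Sum>w\<in>A. \<Sum>s\<in>R. \<Sum>v\<in>A. c w * ech (s * h w) * cnj (c v * ech (s * h v)))"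
    by (rule sum.swap)
  also have "\<dots> = (\<Sum>w\<in>A. \<Sum>v\<in>A. \<Sum>s\<in>R. c w * ech (s * h w) * cnj (c v * ech (s * h v)))"
    by (intro sum.cong refl sum.swap)
  also have "\<dots> = (\<Sum>w\<in>A. \<Sum>v\<in>A. c w * cnj (c v) * (\<Sum>s\<in>R. ech (s * (h w - h v))))"
    unfolding sum_distrib_left right_diff_distrib ech_diff by (simp add: mult_ac)
  also have "\<dots> = (\<Sum>w\<in>A. \<Sum>v\<in>A. if h w \<doteq> h v then c w * cnj (c v) * of_nat p else 0)"
    by (intro sum.cong refl) (simp add: sum_ech cong_dvd)
  finally have "cmod (of_real (\<Sum>s\<in>R. (cmod (\<Sum>w\<in>A. c w * ech (s * h w)))\<^sup>2))
     = cmod (\<Sum>w\<in>A. \<Sum>v\<in>A. if h w \<doteq> h v then c w * cnj (c v) * of_nat p else 0)"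
    by (rule arg_cong)
  then have "(\<Sum>s\<in>R. (cmod (\<Sum>w\<in>A. c w * ech (s * h w)))\<^sup>2)
     = cmod (\<Sum>w\<in>A. \<Sum>v\<in>A. if h w \<doteq> h v then c w * cnj (c v) * of_nat p else 0)"
    unfolding norm_of_real by (simp add: abs_of_nonneg sum_nonneg)
  also have "\<dots> \<le> (\<Sum>w\<in>A. \<Sum>v\<in>A. cmod (if h w \<doteq> h v then c w * cnj (c v) * of_nat p else 0))"
    by (intro order_trans[OF norm_sum] sum_mono norm_sum)
  also have "\<dots> \<le> (\<Sum>w\<in>A. \<Sum>v\<in>A. if h w \<doteq> h v then real p else 0)"
    using c by (intro sum_mono) (auto simp: norm_mult intro!: mult_left_le_one_le mult_le_one)
  also have "\<dots> = (\<Sum>w\<in>A. real p * card {v \<in> A. h w \<doteq> h v})"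
    using A by (simp add: sum.If_cases Int_def mult.commute)
  also have "\<dots> \<le> (\<Sum>w\<in>A. real p * k)"
    using k by (intro sum_mono mult_left_mono) auto
  finally show ?thesis by (simp add: mult_ac)
qed

text \<open>The phase is linear in \<open>s\<close>, and its slope determines \<open>w * w\<close>.\<close>

lemma sum_slope_sum_le:
  assumes "\<not> \<xi> \<doteq> 0" "\<not> m \<doteq> 0"
  shows "(\<Sum>s\<in>R. (cmod (slope_sum \<xi> m s))\<^sup>2) \<le> 2 * real p ^ 2"
proof -
  \<comment> \<open>The phase is split into the part free of \<open>s\<close>, collected in
    \<open>?c\<close>, and the coefficient \<open>?h\<close> of \<open>s\<close>.\<close>
  let ?c = "\<lambda>w. ech (\<xi> * (- 2 * m * w * iv (w * w - m) + w * iv m - iv w))"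
  let ?h = "\<lambda>w. \<xi> * m * iv (w * w - m)"
  have slope_sum: "slope_sum \<xi> m s = (\<Sum>w\<in>slopes m. ?c w * ech (s * ?h w))" for s
    unfolding slope_sum_def slope_phase_def ech_add[symmetric] by (simp add: algebra_simps)
  have "(\<Sum>s\<in>R. (cmod (\<Sum>w\<in>slopes m. ?c w * ech (s * ?h w)))\<^sup>2) \<le> real p * (2 * card (slopes m))"
  proof (rule sum_norm_sq_le[where k = 2, unfolded of_nat_numeral])
    fix w assume w: "w \<in> slopes m"
    show "card {v \<in> slopes m. ?h w \<doteq> ?h v} \<le> 2"
    proof (rule card_subset_pair, safe)
      fix v assume v: "v \<in> slopes m" "?h w \<doteq> ?h v" "v \<notin> {}" "v \<noteq> - w mod int p"
      let ?a = "w * w - m" and ?b = "v * v - m"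
      have ab: "\<not> ?a \<doteq> 0" "\<not> ?b \<doteq> 0" using v w by (auto simp: slopes_def cong_dvd)
      have "iv ?a \<doteq> iv ?b" using v(2) mult_lcancel[of "\<xi> * m"] assms by (simp add: mult_zero_iff)
      then have "?a * iv ?a \<doteq> ?a * iv ?b" by (rule cong_scalar_left)
      then have "?a * iv ?b \<doteq> ?b * iv ?b"
        using iv_right[OF ab(1)] iv_right[OF ab(2)] cong_trans cong_sym by blast
      then have "?b \<doteq> ?a" using mult_lcancel[OF iv_not_zero[OF ab(2)], of ?a ?b]
        by (simp add: mult.commute cong_sym_eq)
      then have "v * v \<doteq> w * w" by (simp add: cong_dvd)
      then show "v = w"
        using v w sq_cong_iff[of v w] mod_cong[of "- w"] cong_R_eq[of v "- w mod int p"] cong_R_eq[of v w]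
        by (auto simp: slopes_def U_iff cong_def)
    qed
  qed auto
  also have "\<dots> \<le> real p * (2 * p)"
    using card_slopes_le[of m] by (intro mult_left_mono) auto
  finally show ?thesis unfolding slope_sum by (simp add: power2_eq_square)
qed

section \<open>Bounds for single Gram entries and their mean square\<close>

lemma card_sq_roots: "card {w \<in> R. w * w \<doteq> m} \<le> 2"
proof (cases "\<exists>v \<in> R. v * v \<doteq> m")
  case True
  then obtain v where v: "v \<in> R" "v * v \<doteq> m" by blast
  show ?thesis
  proof (rule card_subset_pair, safe)
    fix w assume w: "w \<in> R" "w * w \<doteq> m" "w \<notin> {}" "w \<noteq> - v mod int p"
    have "w * w \<doteq> v * v" using w v cong_sym cong_trans by blast
    then show "w = v" using w v(1) sq_cong_iff[of w v] mod_R by (auto simp: cong_def)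
  qed
next
  case False
  then have "{w \<in> R. w * w \<doteq> m} = {}" by blast
  then show ?thesis by (simp only: card.empty)
qed

lemma slope_sum_cong:
  assumes "m \<doteq> m'" "s \<doteq> s'"
  shows "slope_sum \<xi> m s = slope_sum \<xi> m' s'"
  unfolding slope_sum_def
proof (rule sum.cong)
  show "slopes m = slopes m'" using assms(1) cong_sym cong_trans unfolding slopes_def by blast
  fix w
  have "iv (w * w - m) = iv (w * w - m')" "iv m = iv m'"
    using assms(1) by (auto intro!: iv_resp cong_diff)
  then show "ech (\<xi> * slope_phase m s w) = ech (\<xi> * slope_phase m' s' w)"
    unfolding slope_phase_def using assms by (intro ech_cong cong_mult cong_add cong_diff) auto
qed

text \<open>Restoring the slopes \<open>d\<close> and \<open>e\<close> changes the sum by at most 2,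
  and (x + 2)^2 is at most 2 x^2 + 8.\<close>

lemma norm_gram_offdiag:
  assumes "d \<in> U" "e \<in> U" "d \<noteq> e"
  shows "(cmod (gram \<xi> d e))\<^sup>2 \<le> 2 * (cmod (slope_sum \<xi> (d * e) (d + e)))\<^sup>2 + 8"
proof -
  let ?f = "\<lambda>w. ech (\<xi> * slope_phase (d * e) (d + e) w)" and ?A = "slopes (d * e)"
  have split: "slope_sum \<xi> (d * e) (d + e) = sum ?f (?A - {d, e}) + sum ?f (?A \<inter> {d, e})"
    unfolding slope_sum_def by (subst sum.Int_Diff[of _ _ "{d, e}"]) (simp_all add: add.commute)
  have "cmod (sum ?f (?A \<inter> {d, e})) \<le> card (?A \<inter> {d, e})"
    by (rule order_trans[OF norm_sum]) simp
  also have "\<dots> \<le> 2" using card_subset_pair[of "?A \<inter> {d, e}" d e] by simp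
  finally have "cmod (sum ?f (?A - {d, e})) \<le> cmod (slope_sum \<xi> (d * e) (d + e)) + 2"
    unfolding split using norm_triangle_ineq4[of "sum ?f (?A - {d, e}) + sum ?f (?A \<inter> {d, e})" "sum ?f (?A \<inter> {d, e})"]
    by simp
  then have "cmod (gram \<xi> d e) \<le> cmod (slope_sum \<xi> (d * e) (d + e)) + 2"
    using gram_eq_slope_sum[OF assms, of \<xi>] by (simp add: norm_mult)
  then have "(cmod (gram \<xi> d e))\<^sup>2 \<le> (cmod (slope_sum \<xi> (d * e) (d + e)) + 2)\<^sup>2"
    by (intro power_mono) auto
  also have "\<dots> \<le> 2 * (cmod (slope_sum \<xi> (d * e) (d + e)))\<^sup>2 + 8"
    using zero_le_power2[of "cmod (slope_sum \<xi> (d * e) (d + e)) - 2"] by (simp add: power2_eq_square algebra_simps)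
  finally show ?thesis .
qed

text \<open>For equal distances the conic factors as (z - y)(z - (d - y)) = 0. Its two lines carry
  at most 2p points, and the trivial bound is enough on the diagonal.\<close>

lemma norm_gram_diag:
  assumes "d \<in> U"
  shows "cmod (gram \<xi> d d) \<le> 2 * real p"
proof -
  have d: "\<not> d \<doteq> 0" using assms by (simp add: U_iff)
  have sub: "gram_pairs d d \<subseteq> (\<lambda>y. (y, y)) ` U \<union> (\<lambda>y. (y, (d - y) mod int p)) ` U"
  proof clarify
    fix y z assume b: "(y, z) \<in> gram_pairs d d" "(y, z) \<notin> (\<lambda>y. (y, (d - y) mod int p)) ` U"
    then have yz: "y \<in> U" "z \<in> U" "d * (z * (z - d)) \<doteq> d * (y * (y - d))"
      using assms by (auto simp: gram_pairs_iff)
    have "z * (z - d) - y * (y - d) = (z - y) * (z - (d - y))" by (simp add: algebra_simps)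
    then have "(z - y) * (z - (d - y)) \<doteq> 0"
      using yz(3) d by (simp add: mult_lcancel) (simp add: cong_dvd)
    moreover have "\<not> z - (d - y) \<doteq> 0"
    proof
      assume "z - (d - y) \<doteq> 0"
      then have "z \<doteq> d - y" by (simp add: cong_dvd)
      then have "z = (d - y) mod int p" using yz(2) by (simp add: U_iff cong_def mod_R)
      then show False using b yz(1) by blast
    qed
    ultimately have "z \<doteq> y" by (simp add: mult_zero_iff) (simp add: cong_dvd)
    then have "z = y" using yz by (simp add: U_iff cong_R_eq)
    then show "(y, z) \<in> (\<lambda>y. (y, y)) ` U" using yz by blast
  qed
  have "card (gram_pairs d d) \<le> card ((\<lambda>y. (y, y)) ` U \<union> (\<lambda>y. (y, (d - y) mod int p)) ` U)"
    by (rule card_mono[OF _ sub]) simp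
  also have "\<dots> \<le> card U + card U"
    by (intro order_trans[OF card_Un_le] add_mono card_image_le) auto
  also have "\<dots> \<le> 2 * p" by (simp add: card_U)
  finally have card: "card (gram_pairs d d) \<le> 2 * p" .
  have "cmod (gram \<xi> d d) \<le> (\<Sum>x\<in>gram_pairs d d. 1)"
    unfolding gram_def by (rule sum_norm_le) (auto simp: norm_mult)
  then show ?thesis using card by simp
qed

text \<open>All phases are 1, so the entry counts slopes. At most five residues are missing: 0,
  \<open>d\<close>, \<open>e\<close> and two square roots of \<open>d * e\<close>.\<close>

lemma gram_zero_offdiag:
  assumes "d \<in> U" "e \<in> U" "d \<noteq> e"
  shows "(cmod (gram 0 d e - of_nat p))\<^sup>2 \<le> 25"
proof -
  define X where "X = {0, d, e} \<union> {w \<in> R. w * w \<doteq> d * e}"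
  have XR: "X \<subseteq> R" using assms U_subset_R by (auto simp: X_def R_insert_U)
  have "card X \<le> card {0, d, e} + card {w \<in> R. w * w \<doteq> d * e}"
    unfolding X_def by (rule card_Un_le)
  also have "\<dots> \<le> 3 + 2" by (intro add_mono card_sq_roots) (simp add: card_insert_if)
  finally have X: "card X \<le> 5" by simp
  have "slopes (d * e) - {d, e} = R - X" using U_iff by (auto simp: slopes_def X_def R_insert_U)
  then have "gram 0 d e = of_nat (card (R - X))"
    using gram_eq_slope_sum[OF assms, of 0] by simp
  also have "card (R - X) = p - card X"
    using card_Diff_subset[OF finite_subset[OF XR] XR] by simp
  also have "of_nat (p - card X) = (of_nat p - of_nat (card X) :: complex)"
    using card_mono[OF _ XR] by (simp add: of_nat_diff)
  finally have "cmod (gram 0 d e - of_nat p) = card X" by simp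
  then show ?thesis using X power_mono[of "real (card X)" 5 2] by simp
qed

text \<open>Product and sum are the coefficients of a quadratic, whose roots are determined up to
  order.\<close>

lemma card_add_mult_fibre:
  "card {(d, e). (d, e) \<in> U \<times> U \<and> (d * e mod int p, (d + e) mod int p) = b} \<le> 2"
proof (cases "\<exists>d e. (d, e) \<in> U \<times> U \<and> (d * e mod int p, (d + e) mod int p) = b")
  case True
  then obtain d e where de: "d \<in> U" "e \<in> U" "(d * e mod int p, (d + e) mod int p) = b" by blast
  show ?thesis
  proof (rule card_subset_pair[of _ "(d, e)" "(e, d)"], rule subsetI)
    fix x assume "x \<in> {(d, e). (d, e) \<in> U \<times> U \<and> (d * e mod int p, (d + e) mod int p) = b}"
    then obtain d' e' where x: "x = (d', e')"
      and *: "d' \<in> U" "e' \<in> U" "(d' * e' mod int p, (d' + e') mod int p) = b" by auto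
    have m: "int p dvd d' * e' - d * e" and s: "int p dvd (d' + e') - (d + e)"
      using * de unfolding cong_iff_dvd_diff[symmetric] by (auto simp: cong_def)
    have "int p dvd (d' - d) * (d' - e)"
      by (rule dvd_combine[OF _ m s, of _ "- 1" d']) (simp add: algebra_simps)
    then have "d' \<doteq> d \<or> d' \<doteq> e"
      using mult_zero_iff[of "d' - d" "d' - e"] by (simp add: cong_dvd)
    moreover have "e' \<doteq> e" if "d' \<doteq> d"
      unfolding cong_dvd by (rule dvd_combine[OF _ s, of _ 1 "- 1" "d' - d"]) (use that in \<open>simp_all add: cong_dvd\<close>)
    moreover have "e' \<doteq> d" if "d' \<doteq> e"
      unfolding cong_dvd by (rule dvd_combine[OF _ s, of _ 1 "- 1" "d' - e"]) (use that in \<open>simp_all add: cong_dvd\<close>)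
    ultimately show "x \<in> {(d, e), (e, d)}" using * de by (auto simp: x U_iff cong_R_eq)
  qed
next
  case False
  then have "{(d, e). (d, e) \<in> U \<times> U \<and> (d * e mod int p, (d + e) mod int p) = b} = {}" by blast
  then show ?thesis by (simp only: card.empty)
qed

text \<open>At \<open>\<xi> = 0\<close> the off-diagonal Gram entries count the points of a conic, which is \<open>p + O(1)\<close>.\<close>

definition gram_main :: "int \<Rightarrow> complex"
  where "gram_main \<xi> = (if \<xi> = 0 then of_nat p else 0)"

text \<open>The diagonal has fewer than p entries of size O(p); off it the mean square is at most of
  order p. The total is of order p^3 instead of the trivial p^4. The constant is rounded up to a
  square.\<close>

lemma sum_gram_le:
  assumes "\<xi> \<in> R"
  shows "(\<Sum>d\<in>U. \<Sum>e\<in>U. (cmod (gram \<xi> d e - gram_main \<xi>))\<^sup>2) \<le> 36 * real p ^ 3"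
proof -
  have U: "real (card U) \<le> p" by (simp add: card_U)
  then have "real (card U) * real (card U) \<le> real p * real p" by (intro mult_mono) auto
  also have "\<dots> \<le> real p * (real p * real p)" using p_gt_1 by simp
  finally have UU: "real (card U) * real (card U) \<le> real p * (real p * real p)" .
  show ?thesis
  proof (cases "\<xi> = 0")
    case True
    have "(cmod (gram \<xi> d e - gram_main \<xi>))\<^sup>2 \<le> (if d = e then 9 * real p ^ 2 else 0) + 25"
      if "d \<in> U" "e \<in> U" for d e
    proof (cases "d = e")
      case True
      have "cmod (gram \<xi> d e - gram_main \<xi>) \<le> cmod (gram \<xi> d e) + cmod (gram_main \<xi>)"
        by (rule norm_triangle_ineq4)
      also have "\<dots> \<le> 3 * p" using norm_gram_diag[OF that(1), of \<xi>] True \<open>\<xi> = 0\<close> by (simp add: gram_main_def)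
      finally have "(cmod (gram \<xi> d e - gram_main \<xi>))\<^sup>2 \<le> (3 * real p)\<^sup>2" by (intro power_mono) auto
      then show ?thesis using True by (simp add: power2_eq_square)
    next
      case False
      then show ?thesis using gram_zero_offdiag[OF that] \<open>\<xi> = 0\<close> by (simp add: gram_main_def)
    qed
    then have "(\<Sum>d\<in>U. \<Sum>e\<in>U. (cmod (gram \<xi> d e - gram_main \<xi>))\<^sup>2)
        \<le> (\<Sum>d\<in>U. \<Sum>e\<in>U. (if d = e then 9 * real p ^ 2 else 0) + 25)"
      by (intro sum_mono) auto
    also have "\<dots> = card U * (9 * real p ^ 2) + 25 * (card U * card U)"
      by (simp add: sum.distrib algebra_simps)
    also have "\<dots> \<le> p * (9 * real p ^ 2) + 25 * (real p * (real p * real p))"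
      using U UU by (intro add_mono mult_left_mono mult_right_mono) auto
    also have "\<dots> \<le> 36 * real p ^ 3" by (simp add: power2_eq_square power3_eq_cube)
    finally show ?thesis .
  next
    case False
    then have \<xi>: "\<not> \<xi> \<doteq> 0" using assms by (simp add: R_insert_U) (simp add: U_iff)
    let ?S = "\<lambda>(m, s). (cmod (slope_sum \<xi> m s))\<^sup>2" and ?g = "\<lambda>(d, e). (d * e mod int p, (d + e) mod int p)"
    have bound: "(cmod (gram \<xi> d e - gram_main \<xi>))\<^sup>2 \<le> (if d = e then 4 * real p ^ 2 else 0) + 2 * ?S (?g (d, e)) + 8"
      if "d \<in> U" "e \<in> U" for d e
    proof (cases "d = e")
      case True
      have "(cmod (gram \<xi> d e))\<^sup>2 \<le> (2 * real p)\<^sup>2"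
        using norm_gram_diag[OF that(1), of \<xi>] True by (intro power_mono) auto
      then show ?thesis using True \<open>\<xi> \<noteq> 0\<close>
        by (simp add: gram_main_def power_mult_distrib add_increasing2)
    next
      case False
      have "slope_sum \<xi> (d * e) (d + e) = slope_sum \<xi> (d * e mod int p) ((d + e) mod int p)"
        by (rule slope_sum_cong; rule cong_sym[OF mod_cong])
      then show ?thesis using norm_gram_offdiag[OF that False, of \<xi>] \<open>\<xi> \<noteq> 0\<close> False by (simp add: gram_main_def)
    qed
    have "(\<Sum>d\<in>U. \<Sum>e\<in>U. ?S (?g (d, e))) = (\<Sum>x\<in>U \<times> U. ?S (?g x))"
      by (subst sum.cartesian_product) (simp add: case_prod_unfold)
    \<comment> \<open>The map to product and sum is at most two-to-one, so the sum over pairs is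
      dominated by a sum over independent \<open>m\<close> and \<open>s\<close>, where
      \<open>sum_slope_sum_le\<close> applies.\<close>
    also have "\<dots> \<le> real 2 * sum ?S (U \<times> R)"
    proof (rule sum_fibre_le)
      show "?g ` (U \<times> U) \<subseteq> U \<times> R"
        using mult_zero_iff by (auto simp: U_iff cong_def)
      show "card {a \<in> U \<times> U. ?g a = b} \<le> 2" for b
        using card_add_mult_fibre[of b] by (simp add: case_prod_unfold mem_Times_iff)
    qed auto
    also have "sum ?S (U \<times> R) = (\<Sum>m\<in>U. \<Sum>s\<in>R. (cmod (slope_sum \<xi> m s))\<^sup>2)"
      by (simp add: sum.cartesian_product)
    also have "real 2 * \<dots> \<le> real 2 * (\<Sum>m\<in>U. 2 * real p ^ 2)"
      by (intro mult_left_mono sum_mono sum_slope_sum_le \<xi>) (auto simp: U_iff)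
    also have "\<dots> \<le> 4 * real p ^ 3"
      using U by (simp add: power2_eq_square power3_eq_cube)
    finally have main: "(\<Sum>d\<in>U. \<Sum>e\<in>U. ?S (?g (d, e))) \<le> 4 * real p ^ 3" .
    have "(\<Sum>d\<in>U. \<Sum>e\<in>U. (cmod (gram \<xi> d e - gram_main \<xi>))\<^sup>2)
        \<le> (\<Sum>d\<in>U. \<Sum>e\<in>U. (if d = e then 4 * real p ^ 2 else 0) + 2 * ?S (?g (d, e)) + 8)"
      by (intro sum_mono bound)
    also have "\<dots> = card U * (4 * real p ^ 2) + 2 * (\<Sum>d\<in>U. \<Sum>e\<in>U. ?S (?g (d, e))) + 8 * (card U * card U)"
      by (simp add: sum.distrib sum_distrib_left algebra_simps)
    also have "\<dots> \<le> p * (4 * real p ^ 2) + 2 * (4 * real p ^ 3) + 8 * (real p * (real p * real p))"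
      using U UU main by (intro add_mono mult_left_mono mult_right_mono) auto
    also have "\<dots> \<le> 36 * real p ^ 3" by (simp add: power2_eq_square power3_eq_cube)
    finally show ?thesis .
  qed
qed

subsection \<open>Correlations and their Fourier transforms\<close>

text \<open>An unnormalised Fourier coefficient of the correlation of \<open>g\<close> with its
  translate by \<open>d\<close>.\<close>

definition corr :: "(int \<Rightarrow> complex) \<Rightarrow> int \<Rightarrow> int \<Rightarrow> complex"
  where "corr g \<xi> d = (\<Sum>u\<in>R. g u * cnj (g (u - d)) * ech (\<xi> * u))"

definition energy :: "(int \<Rightarrow> complex) \<Rightarrow> real"
  where "energy g = (\<Sum>x\<in>R. (cmod (g x))\<^sup>2)"

lemma energy_nonneg [simp]: "0 \<le> energy g"
  by (simp add: energy_def sum_nonneg)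

lemma sum_cong_single:
  fixes B :: "int \<Rightarrow> complex"
  assumes "periodic B"
  shows "(\<Sum>v\<in>R. if t \<doteq> v then B v else 0) = B t"
proof -
  have "(\<Sum>v\<in>R. if t \<doteq> v then B v else 0) = (\<Sum>v\<in>R. if t mod int p = v then B v else 0)"
    by (intro sum.cong refl) (auto simp: cong_def mod_R)
  also have "\<dots> = B t" using assms by (simp add: periodicD)
  finally show ?thesis .
qed

text \<open>Orthogonality in \<open>\<xi>\<close> forces v = u - a + b, after which u = x + a
  restores the left side. The two translations survive only through the character at
  \<open>a - b\<close>.\<close>

lemma parseval:
  fixes A B :: "int \<Rightarrow> complex"
  assumes "periodic A" "periodic B"
  shows "of_nat p * (\<Sum>x\<in>R. A (x + a) * B (x + b)) =
    (\<Sum>\<xi>\<in>R. (\<Sum>u\<in>R. A u * ech (\<xi> * u)) * (\<Sum>v\<in>R. B v * ech (- \<xi> * v)) * ech (- \<xi> * (a - b)))"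
proof -
  have "(\<Sum>\<xi>\<in>R. (\<Sum>u\<in>R. A u * ech (\<xi> * u)) * (\<Sum>v\<in>R. B v * ech (- \<xi> * v)) * ech (- \<xi> * (a - b)))
      = (\<Sum>\<xi>\<in>R. \<Sum>u\<in>R. \<Sum>v\<in>R. A u * B v * ech (\<xi> * (u - a + b - v)))"
    unfolding sum_product unfolding sum_distrib_right
    by (intro sum.cong refl) (simp add: ech_add[symmetric] algebra_simps)
  also have "\<dots> = (\<Sum>u\<in>R. \<Sum>\<xi>\<in>R. \<Sum>v\<in>R. A u * B v * ech (\<xi> * (u - a + b - v)))"
    by (rule sum.swap)
  also have "\<dots> = (\<Sum>u\<in>R. \<Sum>v\<in>R. \<Sum>\<xi>\<in>R. A u * B v * ech (\<xi> * (u - a + b - v)))"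
    by (intro sum.cong refl sum.swap)
  also have "\<dots> = (\<Sum>u\<in>R. of_nat p * A u * (\<Sum>v\<in>R. if u - a + b \<doteq> v then B v else 0))"
    unfolding sum_distrib_left
    by (intro sum.cong refl) (simp add: sum_ech cong_dvd flip: sum_distrib_left)
  also have "\<dots> = (\<Sum>u\<in>R. of_nat p * A u * B (u - a + b))"
    using assms(2) by (simp add: sum_cong_single)
  also have "\<dots> = (\<Sum>x\<in>R. of_nat p * A (x + a) * B (x + a - a + b))"
  proof (rule sum_shift[symmetric])
    show "periodic (\<lambda>u. of_nat p * A u * B (u - a + b))"
      using periodic_comp[OF assms(1) periodic_diff[OF periodic_add[OF assms(2), of b], of a], of "\<lambda>x y. of_nat p * x * y"]
      by (simp add: algebra_simps)
  qed
  finally show ?thesis by (simp add: sum_distrib_left mult_ac)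
qed

lemma periodic_norm:
  assumes "periodic g"
  shows "periodic (\<lambda>x. (cmod (g x))\<^sup>2)"
  using assms by (simp add: periodic_def)

text \<open>For fixed \<open>d\<close>, Parseval in \<open>\<xi>\<close> gives the correlation of
  the squared moduli at distance \<open>d\<close>; summing over all \<open>d\<close> decouples its
  two factors.\<close>

lemma sum_norm_corr:
  assumes "periodic g"
  shows "(\<Sum>\<xi>\<in>R. \<Sum>d\<in>R. (cmod (corr g \<xi> d))\<^sup>2) = real p * (energy g)\<^sup>2"
proof -
  have "(\<Sum>\<xi>\<in>R. (cmod (corr g \<xi> d))\<^sup>2) = real p * (\<Sum>u\<in>R. (cmod (g u))\<^sup>2 * (cmod (g (u - d)))\<^sup>2)" for d
  proof -
    let ?A = "\<lambda>u. g u * cnj (g (u - d))"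
    have A: "periodic ?A" "periodic (\<lambda>u. cnj (?A u))"
      by (intro periodic_comp[OF assms periodic_diff[OF assms]])+
    have "of_real (\<Sum>\<xi>\<in>R. (cmod (corr g \<xi> d))\<^sup>2) = (\<Sum>\<xi>\<in>R. corr g \<xi> d * cnj (corr g \<xi> d))"
      unfolding of_real_sum complex_norm_square ..
    also have "\<dots> = of_nat p * (\<Sum>x\<in>R. ?A x * cnj (?A x))"
      using parseval[OF A, of 0 0] by (simp add: corr_def cnj_sum ech_uminus)
    also have "\<dots> = of_real (real p * (\<Sum>u\<in>R. (cmod (g u))\<^sup>2 * (cmod (g (u - d)))\<^sup>2))"
      unfolding complex_norm_square[symmetric] by (simp add: norm_mult power_mult_distrib)
    finally show ?thesis unfolding of_real_eq_iff .
  qed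
  then have "(\<Sum>\<xi>\<in>R. \<Sum>d\<in>R. (cmod (corr g \<xi> d))\<^sup>2)
      = (\<Sum>d\<in>R. real p * (\<Sum>u\<in>R. (cmod (g u))\<^sup>2 * (cmod (g (u - d)))\<^sup>2))"
    by (subst sum.swap) simp
  also have "\<dots> = real p * (\<Sum>d\<in>R. \<Sum>u\<in>R. (cmod (g u))\<^sup>2 * (cmod (g (u - d)))\<^sup>2)"
    unfolding sum_distrib_left ..
  also have "(\<Sum>d\<in>R. \<Sum>u\<in>R. (cmod (g u))\<^sup>2 * (cmod (g (u - d)))\<^sup>2)
      = (\<Sum>u\<in>R. \<Sum>d\<in>R. (cmod (g u))\<^sup>2 * (cmod (g (u - d)))\<^sup>2)"
    by (rule sum.swap)
  also have "real p * \<dots> = real p * (\<Sum>u\<in>R. (cmod (g u))\<^sup>2 * energy g)"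
    unfolding sum_distrib_left[symmetric] sum_reflect[OF periodic_norm[OF assms]] energy_def ..
  finally show ?thesis by (simp add: energy_def sum_distrib_right[symmetric] power2_eq_square)
qed

lemma sum_norm_corr_uminus:
  assumes "periodic g"
  shows "(\<Sum>\<xi>\<in>R. \<Sum>d\<in>R. (cmod (corr g (- \<xi>) d))\<^sup>2) = real p * (energy g)\<^sup>2"
proof -
  have "periodic (\<lambda>\<xi>. \<Sum>d\<in>R. (cmod (corr g \<xi> d))\<^sup>2)"
  proof (rule periodicI)
    fix x y :: int assume "x \<doteq> y"
    then have "ech (x * u) = ech (y * u)" for u by (intro ech_cong cong_scalar_right)
    then show "(\<Sum>d\<in>R. (cmod (corr g x d))\<^sup>2) = (\<Sum>d\<in>R. (cmod (corr g y d))\<^sup>2)"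
      by (simp add: corr_def)
  qed
  from sum_reflect[OF this, of 0] show ?thesis using sum_norm_corr[OF assms] by simp
qed

text \<open>For fixed u the argument u - d runs through all residues. This is where mean zero
  enters: it removes the main term of the Gram matrix at frequency zero.\<close>

lemma sum_corr_zero:
  assumes "periodic g" "(\<Sum>x\<in>R. g x) = 0"
  shows "(\<Sum>d\<in>R. corr g 0 d) = 0"
proof -
  have "periodic (\<lambda>x. cnj (g x))" using assms(1) by (simp add: periodic_def)
  from sum_reflect[OF this] have "(\<Sum>d\<in>R. cnj (g (u - d))) = 0" for u
    using assms(2) by (simp flip: cnj_sum)
  moreover have "(\<Sum>d\<in>R. corr g 0 d) = (\<Sum>u\<in>R. g u * (\<Sum>d\<in>R. cnj (g (u - d))))"
    unfolding corr_def by (subst sum.swap) (simp add: sum_distrib_left)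
  ultimately show ?thesis by simp
qed

text \<open>With \<open>gram_main\<close> split off, Cauchy-Schwarz over pairs bounds the form by
  the Hilbert-Schmidt norm, at most 6 p^(3/2) by \<open>sum_gram_le\<close>. The split-off part
  lives at \<open>\<xi> = 0\<close> only, is at most p times \<open>E\<close>, and raises 6 to
  7.\<close>

lemma gram_form_le:
  assumes "periodic g" "(\<Sum>x\<in>R. g x) = 0" "\<xi> \<in> R"
  shows "cmod (\<Sum>d\<in>U. \<Sum>e\<in>U. corr g \<xi> d * cnj (corr g \<xi> e) * gram \<xi> d e)
    \<le> 7 * (real p * sqrt p) * (\<Sum>d\<in>R. (cmod (corr g \<xi> d))\<^sup>2)"
proof -
  let ?f = "corr g \<xi>"
  define E where "E = (\<Sum>d\<in>R. (cmod (?f d))\<^sup>2)"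
  have E: "0 \<le> E" "(\<Sum>d\<in>U. (cmod (?f d))\<^sup>2) \<le> E" "(cmod (?f 0))\<^sup>2 \<le> E"
    unfolding E_def by (auto simp: sum_nonneg R_insert_U)
  let ?a = "\<lambda>(d, e). ?f d * cnj (?f e)" and ?b = "\<lambda>(d, e). gram \<xi> d e - gram_main \<xi>"
  have a: "(\<Sum>x\<in>U\<times>U. (cmod (?a x))\<^sup>2) = (\<Sum>d\<in>U. (cmod (?f d))\<^sup>2)\<^sup>2"
    unfolding power2_eq_square[of "sum _ _"] sum_product sum.cartesian_product
    by (intro sum.cong refl) (auto simp: norm_mult power_mult_distrib)
  have b: "(\<Sum>x\<in>U\<times>U. (cmod (?b x))\<^sup>2) = (\<Sum>d\<in>U. \<Sum>e\<in>U. (cmod (gram \<xi> d e - gram_main \<xi>))\<^sup>2)"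
    unfolding sum.cartesian_product by (intro sum.cong refl) auto
  have "(cmod (\<Sum>x\<in>U\<times>U. ?a x * ?b x))\<^sup>2 \<le> (\<Sum>d\<in>U. (cmod (?f d))\<^sup>2)\<^sup>2 * (36 * real p ^ 3)"
    by (rule order_trans[OF norm_sum_mult_le])
      (unfold a b, intro mult_left_mono sum_gram_le assms, simp)
  also have "\<dots> \<le> E\<^sup>2 * (36 * real p ^ 3)"
    by (intro mult_right_mono power_mono E sum_nonneg) auto
  also have "\<dots> = (6 * (real p * sqrt p) * E)\<^sup>2"
    by (simp add: power_mult_distrib) (simp add: power2_eq_square power3_eq_cube)
  finally have 1: "cmod (\<Sum>x\<in>U\<times>U. ?a x * ?b x) \<le> 6 * (real p * sqrt p) * E"
    by (rule power2_le_imp_le) (use E in auto)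
  have 2: "cmod (gram_main \<xi> * (\<Sum>d\<in>U. ?f d) * (\<Sum>e\<in>U. cnj (?f e))) \<le> real p * sqrt p * E"
  proof (cases "\<xi> = 0")
    case True
    \<comment> \<open>The sum over all residues vanishes, so the sum over the nonzero ones is minus
      the term at 0.\<close>
    have "(\<Sum>d\<in>U. ?f d) = - ?f 0"
      using sum_corr_zero[OF assms(1,2)] True by (simp add: R_insert_U add_eq_0_iff)
    then have "cmod (gram_main \<xi> * (\<Sum>d\<in>U. ?f d) * (\<Sum>e\<in>U. cnj (?f e))) = p * (cmod (?f 0))\<^sup>2"
      using True by (simp add: gram_main_def norm_mult power2_eq_square flip: cnj_sum)
    also have "\<dots> \<le> p * (sqrt p * E)"
      using E(3) mult_mono[of 1 "sqrt p" "(cmod (?f 0))\<^sup>2" E] p_gt_1 E(1) by (intro mult_left_mono) auto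
    finally show ?thesis by simp
  qed (use E(1) in \<open>simp add: gram_main_def\<close>)
  have "(\<Sum>d\<in>U. \<Sum>e\<in>U. ?f d * cnj (?f e) * gram \<xi> d e)
     = (\<Sum>x\<in>U\<times>U. ?a x * ?b x) + gram_main \<xi> * (\<Sum>d\<in>U. ?f d) * (\<Sum>e\<in>U. cnj (?f e))"
  proof -
    have "(\<Sum>x\<in>U\<times>U. ?a x * ?b x) = (\<Sum>d\<in>U. \<Sum>e\<in>U. ?f d * cnj (?f e) * (gram \<xi> d e - gram_main \<xi>))"
      unfolding sum.cartesian_product by (intro sum.cong refl) auto
    also have "\<dots> = (\<Sum>d\<in>U. \<Sum>e\<in>U. ?f d * cnj (?f e) * gram \<xi> d e) - (\<Sum>d\<in>U. \<Sum>e\<in>U. gram_main \<xi> * (?f d * cnj (?f e)))"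
      unfolding sum_subtractf[symmetric] by (intro sum.cong refl) (simp add: algebra_simps)
    also have "(\<Sum>d\<in>U. \<Sum>e\<in>U. gram_main \<xi> * (?f d * cnj (?f e))) = gram_main \<xi> * (\<Sum>d\<in>U. ?f d) * (\<Sum>e\<in>U. cnj (?f e))"
      by (simp add: sum_product mult.assoc flip: sum_distrib_left)
    finally show ?thesis by simp
  qed
  then have "cmod (\<Sum>d\<in>U. \<Sum>e\<in>U. ?f d * cnj (?f e) * gram \<xi> d e) \<le> 6 * (real p * sqrt p) * E + real p * sqrt p * E"
    using norm_triangle_mono[OF 1 2] by simp
  then show ?thesis by (simp add: E_def)
qed

subsection \<open>The square of the convolution\<close>

definition conv_sum :: "(int \<Rightarrow> complex) \<Rightarrow> (int \<Rightarrow> complex) \<Rightarrow> int \<Rightarrow> complex"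
  where "conv_sum g1 g2 x = (\<Sum>y\<in>U. g1 (x + y) * g2 (x + iv y))"

text \<open>The contribution of the pair \<open>y\<close>, \<open>z\<close> to the sum over x of the
  squared modulus of \<open>conv_sum\<close>.\<close>

definition shift_corr :: "(int \<Rightarrow> complex) \<Rightarrow> (int \<Rightarrow> complex) \<Rightarrow> int \<Rightarrow> int \<Rightarrow> complex"
  where "shift_corr g1 g2 y z = (\<Sum>x\<in>R. g1 (x + y) * g2 (x + iv y) * cnj (g1 (x + z) * g2 (x + iv z)))"

text \<open>The part at frequency \<open>\<xi>\<close> of the pairs \<open>y\<close> and z =
  \<open>y - d\<close> with z nonzero. The second distance is reduced so that it can index the
  columns in \<open>R\<close>.\<close>

definition freq_form :: "(int \<Rightarrow> complex) \<Rightarrow> (int \<Rightarrow> complex) \<Rightarrow> int \<Rightarrow> complex"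
  where "freq_form g1 g2 \<xi> = (\<Sum>d\<in>U. \<Sum>y\<in>{y \<in> U. \<not> y - d \<doteq> 0}. corr g1 \<xi> d *
    corr g2 (- \<xi>) ((iv y - iv (y - d)) mod int p) * ech (- \<xi> * (y - iv y)))"

lemma corr_mod:
  assumes "periodic g"
  shows "corr g \<xi> (d mod int p) = corr g \<xi> d"
  unfolding corr_def
  by (intro sum.cong refl arg_cong2[of _ _ _ _ "(*)"] arg_cong[of _ _ cnj] periodic_cong[OF assms] cong_diff cong_refl mod_cong)

text \<open>The columns are the distances of \<open>g2\<close>; two terms share a column precisely
  when their indices form one of the \<open>gram_pairs\<close>.\<close>

lemma norm_freq_form_le:
  assumes "periodic g1" "(\<Sum>x\<in>R. g1 x) = 0" "\<xi> \<in> R"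
  shows "(cmod (freq_form g1 g2 \<xi>))\<^sup>2 \<le> 7 * (real p * sqrt p) *
    ((\<Sum>d\<in>R. (cmod (corr g1 \<xi> d))\<^sup>2) * (\<Sum>c\<in>R. (cmod (corr g2 (- \<xi>) c))\<^sup>2))"
proof -
  let ?Y = "\<lambda>d. {y \<in> U. \<not> y - d \<doteq> 0}" and ?k = "\<lambda>d y. (iv y - iv (y - d)) mod int p"
  let ?u = "\<lambda>d y. ech (- \<xi> * (y - iv y))"
  have gram_pairs: "{(y, z). y \<in> ?Y d \<and> z \<in> ?Y e \<and> ?k d y = ?k e z} = gram_pairs d e" for d e
    by (auto simp: gram_pairs_def cong_def)
  have "(cmod (freq_form g1 g2 \<xi>))\<^sup>2 \<le> (\<Sum>c\<in>R. (cmod (corr g2 (- \<xi>) c))\<^sup>2) *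
      cmod (\<Sum>d\<in>U. \<Sum>e\<in>U. corr g1 \<xi> d * cnj (corr g1 \<xi> e) *
        (\<Sum>(y, z)\<in>{(y, z). y \<in> ?Y d \<and> z \<in> ?Y e \<and> ?k d y = ?k e z}. ?u d y * cnj (?u e z)))"
    unfolding freq_form_def by (rule norm_bilinear_sum_le) auto
  also have "\<dots> = (\<Sum>c\<in>R. (cmod (corr g2 (- \<xi>) c))\<^sup>2) *
      cmod (\<Sum>d\<in>U. \<Sum>e\<in>U. corr g1 \<xi> d * cnj (corr g1 \<xi> e) * gram \<xi> d e)"
    unfolding gram_pairs gram_def ..
  also have "\<dots> \<le> (\<Sum>c\<in>R. (cmod (corr g2 (- \<xi>) c))\<^sup>2) *
      (7 * (real p * sqrt p) * (\<Sum>d\<in>R. (cmod (corr g1 \<xi> d))\<^sup>2))"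
    by (intro mult_left_mono gram_form_le assms sum_nonneg) auto
  finally show ?thesis by (simp add: mult_ac)
qed

text \<open>Cauchy-Schwarz over the frequencies, where each factor is evaluated exactly by
  \<open>sum_norm_corr\<close>.\<close>

lemma sum_freq_form_le:
  assumes "periodic g1" "periodic g2" "(\<Sum>x\<in>R. g1 x) = 0"
  shows "cmod (\<Sum>\<xi>\<in>R. freq_form g1 g2 \<xi>) \<le> real p * (sqrt (7 * (real p * sqrt p)) * (energy g1 * energy g2))"
proof -
  define K where "K = sqrt (7 * (real p * sqrt p))"
  let ?A = "\<lambda>\<xi>. \<Sum>d\<in>R. (cmod (corr g1 \<xi> d))\<^sup>2" and ?B = "\<lambda>\<xi>. \<Sum>d\<in>R. (cmod (corr g2 (- \<xi>) d))\<^sup>2"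
  have nn: "0 \<le> ?A \<xi>" "0 \<le> ?B \<xi>" for \<xi> by (simp_all add: sum_nonneg)
  have "cmod (freq_form g1 g2 \<xi>) \<le> K * (sqrt (?A \<xi>) * sqrt (?B \<xi>))" if "\<xi> \<in> R" for \<xi>
    using real_sqrt_le_mono[OF norm_freq_form_le[OF assms(1,3) that, of g2]]
    by (simp add: K_def real_sqrt_mult)
  then have "cmod (\<Sum>\<xi>\<in>R. freq_form g1 g2 \<xi>) \<le> (\<Sum>\<xi>\<in>R. K * (sqrt (?A \<xi>) * sqrt (?B \<xi>)))"
    by (intro sum_norm_le)
  also have "\<dots> = K * (\<Sum>\<xi>\<in>R. sqrt (?A \<xi>) * sqrt (?B \<xi>))"
    by (rule sum_distrib_left[symmetric])
  also have "\<dots> \<le> K * (real p * (energy g1 * energy g2))"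
  proof (rule mult_left_mono)
    have "(\<Sum>\<xi>\<in>R. sqrt (?A \<xi>) * sqrt (?B \<xi>))\<^sup>2 \<le> (\<Sum>\<xi>\<in>R. (sqrt (?A \<xi>))\<^sup>2) * (\<Sum>\<xi>\<in>R. (sqrt (?B \<xi>))\<^sup>2)"
      by (rule Cauchy_Schwarz_ineq_sum)
    also have "\<dots> = (\<Sum>\<xi>\<in>R. ?A \<xi>) * (\<Sum>\<xi>\<in>R. ?B \<xi>)"
      using nn by simp
    also have "\<dots> = (real p * (energy g1 * energy g2))\<^sup>2"
      unfolding sum_norm_corr[OF assms(1)] sum_norm_corr_uminus[OF assms(2)]
      by (simp add: power2_eq_square)
    finally show "(\<Sum>\<xi>\<in>R. sqrt (?A \<xi>) * sqrt (?B \<xi>)) \<le> real p * (energy g1 * energy g2)"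
      by (rule power2_le_imp_le) simp
  qed (simp add: K_def)
  finally show ?thesis by (simp add: K_def mult_ac)
qed

text \<open>\<open>parseval\<close> is applied to the correlation of \<open>g1\<close> at distance
  \<open>d\<close>, shifted by \<open>y\<close>, and to that of \<open>g2\<close> at the distance of
  the inverses, shifted by \<open>iv y\<close>.\<close>

lemma shift_corr_eq:
  assumes "periodic g1" "periodic g2"
  shows "of_nat p * shift_corr g1 g2 y ((y - d) mod int p) = (\<Sum>\<xi>\<in>R. corr g1 \<xi> d *
    corr g2 (- \<xi>) ((iv y - iv (y - d)) mod int p) * ech (- \<xi> * (y - iv y)))"
proof -
  let ?c = "iv y - iv (y - d)"
  let ?A = "\<lambda>u. g1 u * cnj (g1 (u - d))" and ?B = "\<lambda>u. g2 u * cnj (g2 (u - ?c))"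
  have "periodic ?A"
    by (rule periodic_comp[OF assms(1) periodic_diff[OF assms(1)], of "\<lambda>a b. a * cnj b"])
  moreover have "periodic ?B"
    by (rule periodic_comp[OF assms(2) periodic_diff[OF assms(2)], of "\<lambda>a b. a * cnj b"])
  ultimately have par: "of_nat p * (\<Sum>x\<in>R. ?A (x + y) * ?B (x + iv y)) =
    (\<Sum>\<xi>\<in>R. (\<Sum>u\<in>R. ?A u * ech (\<xi> * u)) * (\<Sum>v\<in>R. ?B v * ech (- \<xi> * v)) * ech (- \<xi> * (y - iv y)))"
    by (rule parseval)
  have "g1 (x + (y - d) mod int p) = g1 (x + y - d)" for x
    using periodic_cong[OF assms(1) cong_add[OF cong_refl mod_cong], of x "y - d"] by (simp add: add_diff_eq)
  then have "shift_corr g1 g2 y ((y - d) mod int p) = (\<Sum>x\<in>R. ?A (x + y) * ?B (x + iv y))"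
    unfolding shift_corr_def iv_mod by (intro sum.cong refl) (simp add: algebra_simps)
  then show ?thesis using par unfolding corr_mod[OF assms(2)] by (simp add: corr_def)
qed

text \<open>Substitute d = y - z: here z different from y means d nonzero, and z nonzero means d
  different from y.\<close>

lemma sum_offdiag:
  assumes "periodic g1" "periodic g2"
  shows "of_nat p * (\<Sum>y\<in>U. \<Sum>z\<in>U - {y}. shift_corr g1 g2 y z) = (\<Sum>\<xi>\<in>R. freq_form g1 g2 \<xi>)"
proof -
  have "(\<Sum>z\<in>U - {y}. shift_corr g1 g2 y z) = (\<Sum>d\<in>{d \<in> U. \<not> y - d \<doteq> 0}. shift_corr g1 g2 y ((y - d) mod int p))"
    if y: "y \<in> U" for y
  proof (rule sum.reindex_bij_witness[of _ "\<lambda>d. (y - d) mod int p" "\<lambda>z. (y - z) mod int p"])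
    fix z assume z: "z \<in> U - {y}"
    show "(y - (y - z) mod int p) mod int p = z"
      using z by (simp add: mod_diff_right_eq U_iff mod_R)
    show "(y - z) mod int p \<in> {d \<in> U. \<not> y - d \<doteq> 0}"
      using z y cong_R_eq[of y z] by (auto simp: U_iff diff_cong_0_iff cong_diff_self_iff)
    show "shift_corr g1 g2 y ((y - (y - z) mod int p) mod int p) = shift_corr g1 g2 y z"
      using z by (simp add: mod_diff_right_eq U_iff mod_R)
  next
    fix d assume d: "d \<in> {d \<in> U. \<not> y - d \<doteq> 0}"
    show "(y - (y - d) mod int p) mod int p = d"
      using d by (simp add: mod_diff_right_eq U_iff mod_R)
    have "(y - d) mod int p \<noteq> y"
      using d cong_diff_self_iff[of y d] y by (auto simp: U_iff cong_def mod_R)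
    then show "(y - d) mod int p \<in> U - {y}"
      using d by (simp add: U_iff)
  qed
  then have "of_nat p * (\<Sum>y\<in>U. \<Sum>z\<in>U - {y}. shift_corr g1 g2 y z)
      = (\<Sum>y\<in>U. \<Sum>d\<in>{d \<in> U. \<not> y - d \<doteq> 0}. of_nat p * shift_corr g1 g2 y ((y - d) mod int p))"
    by (simp add: sum_distrib_left)
  also have "\<dots> = (\<Sum>y\<in>U. \<Sum>d\<in>{d \<in> U. \<not> y - d \<doteq> 0}. \<Sum>\<xi>\<in>R. corr g1 \<xi> d *
    corr g2 (- \<xi>) ((iv y - iv (y - d)) mod int p) * ech (- \<xi> * (y - iv y)))"
    unfolding shift_corr_eq[OF assms] ..
  also have "\<dots> = (\<Sum>d\<in>U. \<Sum>y\<in>{y \<in> U. \<not> y - d \<doteq> 0}. \<Sum>\<xi>\<in>R. corr g1 \<xi> d *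
    corr g2 (- \<xi>) ((iv y - iv (y - d)) mod int p) * ech (- \<xi> * (y - iv y)))"
    by (rule sum.swap_restrict) auto
  also have "\<dots> = (\<Sum>\<xi>\<in>R. freq_form g1 g2 \<xi>)"
    unfolding freq_form_def by (subst sum.swap) (simp add: sum.swap[of _ _ R])
  finally show ?thesis .
qed

text \<open>After translating x by \<open>y\<close>, the argument of \<open>g2\<close> is u - y +
  1/y, which takes each value at most twice by \<open>sub_iv_fibre\<close>. Hence the factor 2,
  uniformly in p.\<close>

lemma sum_diag_le:
  assumes "periodic g1" "periodic g2"
  shows "cmod (\<Sum>y\<in>U. shift_corr g1 g2 y y) \<le> 2 * (energy g1 * energy g2)"
proof -
  have "cmod (shift_corr g1 g2 y y) \<le> (\<Sum>u\<in>R. (cmod (g1 u))\<^sup>2 * (cmod (g2 (u - y + iv y)))\<^sup>2)" for y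
  proof -
    have per: "periodic (\<lambda>u. (cmod (g1 u))\<^sup>2 * (cmod (g2 (u - y + iv y)))\<^sup>2)"
      by (rule periodic_comp[OF assms(1) periodic_diff[OF periodic_add[OF assms(2), of "iv y"], of y], of "\<lambda>a b. (cmod a)\<^sup>2 * (cmod b)\<^sup>2"])
    have "cmod (shift_corr g1 g2 y y) \<le> (\<Sum>x\<in>R. (cmod (g1 (x + y)))\<^sup>2 * (cmod (g2 (x + iv y)))\<^sup>2)"
      unfolding shift_corr_def by (rule sum_norm_le) (simp add: norm_mult power2_eq_square)
    also have "\<dots> = (\<Sum>u\<in>R. (cmod (g1 u))\<^sup>2 * (cmod (g2 (u - y + iv y)))\<^sup>2)"
      using sum_shift[OF per, of y] by simp
    finally show ?thesis .
  qed
  then have "cmod (\<Sum>y\<in>U. shift_corr g1 g2 y y) \<le> (\<Sum>y\<in>U. \<Sum>u\<in>R. (cmod (g1 u))\<^sup>2 * (cmod (g2 (u - y + iv y)))\<^sup>2)"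
    by (intro sum_norm_le)
  also have "\<dots> = (\<Sum>u\<in>R. (cmod (g1 u))\<^sup>2 * (\<Sum>y\<in>U. (cmod (g2 (u - y + iv y)))\<^sup>2))"
    unfolding sum_distrib_left by (rule sum.swap)
  also have "\<dots> \<le> (\<Sum>u\<in>R. (cmod (g1 u))\<^sup>2 * (2 * energy g2))"
  proof (intro sum_mono mult_left_mono)
    fix u
    have "(\<Sum>y\<in>U. (cmod (g2 ((u - y + iv y) mod int p)))\<^sup>2) \<le> real 2 * energy g2"
      unfolding energy_def
    proof (rule sum_fibre_le)
      fix b
      show "card {y \<in> U. (u - y + iv y) mod int p = b} \<le> 2"
      proof (cases "\<exists>y. y \<in> U \<and> (u - y + iv y) mod int p = b")
        case True
        then obtain y where y: "y \<in> U" "(u - y + iv y) mod int p = b" by blast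
        show ?thesis
        proof (rule card_subset_pair[of _ y "(- iv y) mod int p"], rule subsetI)
          fix z assume "z \<in> {y \<in> U. (u - y + iv y) mod int p = b}"
          then have z: "z \<in> U" "u - z + iv z \<doteq> u - y + iv y" using y by (auto simp: cong_def)
          have "u - (u - z + iv z) \<doteq> u - (u - y + iv y)" by (intro cong_diff cong_refl z)
          then have "y - iv y \<doteq> z - iv z" by (simp add: cong_sym_eq)
          then have "z \<doteq> y \<or> z \<doteq> - iv y" using sub_iv_fibre[of y z] y z by (auto simp: U_iff)
          then show "z \<in> {y, (- iv y) mod int p}" using y z by (auto simp: U_iff cong_def mod_R)
        qed
      next
        case False
        then have "{y \<in> U. (u - y + iv y) mod int p = b} = {}" by blast
        then show ?thesis by (simp only: card.empty)
      qed
    qed auto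
    then show "(\<Sum>y\<in>U. (cmod (g2 (u - y + iv y)))\<^sup>2) \<le> 2 * energy g2"
      by (simp add: periodicD[OF assms(2)])
  qed simp
  also have "\<dots> = 2 * (energy g1 * energy g2)"
    by (simp add: energy_def sum_distrib_right[symmetric])
  finally show ?thesis .
qed

text \<open>The diagonal costs a constant and the other pairs a multiple of p^(3/4), against the
  factor 2p that Cauchy-Schwarz in \<open>y\<close> alone would give.\<close>

lemma sum_conv_sum_le:
  assumes "periodic g1" "periodic g2" "(\<Sum>x\<in>R. g1 x) = 0"
  shows "(\<Sum>x\<in>R. (cmod (conv_sum g1 g2 x))\<^sup>2) \<le> (2 + sqrt (7 * (real p * sqrt p))) * (energy g1 * energy g2)"
proof -
  let ?D = "\<Sum>y\<in>U. shift_corr g1 g2 y y" and ?O = "\<Sum>y\<in>U. \<Sum>z\<in>U - {y}. shift_corr g1 g2 y z"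
  have "of_real (\<Sum>x\<in>R. (cmod (conv_sum g1 g2 x))\<^sup>2) = (\<Sum>x\<in>R. \<Sum>y\<in>U. \<Sum>z\<in>U.
      g1 (x + y) * g2 (x + iv y) * cnj (g1 (x + z) * g2 (x + iv z)))"
    unfolding of_real_sum conv_sum_def norm_sum_sq ..
  also have "\<dots> = (\<Sum>y\<in>U. \<Sum>x\<in>R. \<Sum>z\<in>U. g1 (x + y) * g2 (x + iv y) * cnj (g1 (x + z) * g2 (x + iv z)))"
    by (rule sum.swap)
  also have "\<dots> = (\<Sum>y\<in>U. \<Sum>z\<in>U. shift_corr g1 g2 y z)"
    unfolding shift_corr_def by (intro sum.cong refl sum.swap)
  also have "\<dots> = (\<Sum>y\<in>U. shift_corr g1 g2 y y + (\<Sum>z\<in>U - {y}. shift_corr g1 g2 y z))"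
    by (intro sum.cong refl sum.remove) auto
  also have "\<dots> = ?D + ?O" by (rule sum.distrib)
  finally have "(\<Sum>x\<in>R. (cmod (conv_sum g1 g2 x))\<^sup>2) = cmod (?D + ?O)"
    by (rule of_real_eq_norm) (simp add: sum_nonneg)
  also have "\<dots> \<le> cmod ?D + cmod ?O" by (rule norm_triangle_ineq)
  also have "\<dots> \<le> 2 * (energy g1 * energy g2) + sqrt (7 * (real p * sqrt p)) * (energy g1 * energy g2)"
  proof (intro add_mono sum_diag_le assms)
    have "real p * cmod ?O = cmod (\<Sum>\<xi>\<in>R. freq_form g1 g2 \<xi>)"
      using arg_cong[OF sum_offdiag[OF assms(1,2)], of cmod] by (simp add: norm_mult)
    also note sum_freq_form_le[OF assms]
    finally show "cmod ?O \<le> sqrt (7 * (real p * sqrt p)) * (energy g1 * energy g2)"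
      by (rule mult_left_le_imp_le) simp
  qed
  finally show ?thesis by (simp add: ring_distribs)
qed

subsection \<open>The normalised estimate\<close>

text \<open>Periodic extension from the residues to all integers.\<close>

definition lift :: "(nat \<Rightarrow> complex) \<Rightarrow> int \<Rightarrow> complex"
  where "lift f x = f (nat (x mod int p))"

lemma periodic_lift: "periodic (lift f)"
  by (simp add: periodic_def lift_def)

lemma lift_of_nat: "lift f (int n) = f (n mod p)"
  by (simp add: lift_def nat_mod_as_int)

lemma sum_R_nat:
  fixes h :: "int \<Rightarrow> 'a::comm_monoid_add"
  shows "(\<Sum>x\<in>R. h x) = (\<Sum>x<p. h (int x))"
  by (rule sum.reindex_bij_witness[of _ int nat]) (auto simp: R_def)

lemma sum_U_nat:
  fixes h :: "int \<Rightarrow> 'a::comm_monoid_add"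
  shows "(\<Sum>x\<in>U. h x) = (\<Sum>x\<in>{1..<p}. h (int x))"
  by (rule sum.reindex_bij_witness[of _ int nat]) (auto simp: U_def)

lemma iv_of_nat: "y < p \<Longrightarrow> iv (int y) = int (fp_inv p y)"
  by (simp add: iv_def)

lemma conv_F_eq: "conv_F p f1 f2 x = conv_sum (lift f1) (lift f2) (int x) / of_nat p"
  unfolding conv_F_def conv_sum_def sum_U_nat
  by (intro arg_cong2[of _ _ _ _ "(/)"] sum.cong refl)
    (simp add: iv_of_nat lift_of_nat flip: of_nat_add)

lemma iv_iv:
  assumes "y \<in> U"
  shows "iv (iv y) = y"
proof -
  have y: "\<not> y \<doteq> 0" "y \<in> R" using assms by (auto simp: U_iff)
  have "iv (iv y) \<doteq> y"
    using iv_cong[OF iv_not_zero[OF y(1)], of y] iv_right[OF y(1)] by (simp add: mult.commute)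
  then show ?thesis using iv_range[OF iv_not_zero[OF y(1)]] y by (simp add: cong_R_eq)
qed

lemma iv_in_U: "y \<in> U \<Longrightarrow> iv y \<in> U"
  using iv_range iv_not_zero by (simp add: U_iff)

lemma sum_iv: "(\<Sum>y\<in>U. h (iv y)) = (\<Sum>y\<in>U. h y)"
  by (rule sum.reindex_bij_witness[of _ iv iv]) (auto simp: iv_iv iv_in_U)

text \<open>Inversion permutes the nonzero residues, so x + 1/y takes every value except x. That
  missing value is the error made by omitting y = 0.\<close>

lemma conv_sum_const:
  assumes "periodic g"
  shows "conv_sum (\<lambda>_. c) g x = c * ((\<Sum>v\<in>R. g v) - g x)"
proof -
  have "(\<Sum>y\<in>U. g (x + iv y)) = (\<Sum>y\<in>U. g (x + y))" by (rule sum_iv)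
  also have "\<dots> = (\<Sum>y\<in>R. g (y + x)) - g x" by (simp add: R_insert_U add.commute)
  also have "\<dots> = (\<Sum>y\<in>R. g y) - g x" by (simp only: sum_shift[OF assms])
  finally show ?thesis by (simp add: conv_sum_def flip: sum_distrib_left)
qed

lemma sum_lift: "(\<Sum>x\<in>R. lift f x) = of_nat p * fp_mean p f"
  by (simp add: sum_R_nat lift_of_nat fp_mean_def)

lemma energy_lift: "energy (lift f) = (\<Sum>x<p. (cmod (f x))\<^sup>2)"
  by (simp add: energy_def sum_R_nat lift_of_nat)

lemma fp_norm2_sq: "(fp_norm2 p f)\<^sup>2 = energy (lift f) / p"
  by (simp add: fp_norm2_def energy_lift sum_nonneg)

text \<open>Pythagoras: a function of mean zero is orthogonal to the constants. It bounds both the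
  centred part and the mean by the energy of \<open>f\<close>.\<close>

lemma energy_minus_mean:
  "energy (\<lambda>x. lift f x - fp_mean p f) + real p * (cmod (fp_mean p f))\<^sup>2 = energy (lift f)"
proof -
  let ?m = "fp_mean p f"
  have "complex_of_real (energy (\<lambda>x. lift f x - ?m))
      = (\<Sum>x\<in>R. (lift f x - ?m) * cnj (lift f x - ?m))"
    unfolding energy_def of_real_sum complex_norm_square ..
  also have "\<dots> = (\<Sum>x\<in>R. lift f x * cnj (lift f x)) - ?m * cnj (\<Sum>x\<in>R. lift f x)
      - (\<Sum>x\<in>R. lift f x) * cnj ?m + of_nat p * (?m * cnj ?m)"
    by (simp add: algebra_simps sum.distrib sum_subtractf cnj_sum sum_distrib_left)
  also have "\<dots> = (\<Sum>x\<in>R. lift f x * cnj (lift f x)) - of_nat p * (?m * cnj ?m)"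
    by (simp add: sum_lift)
  also have "\<dots> = of_real (energy (lift f) - real p * (cmod ?m)\<^sup>2)"
    by (simp add: energy_def complex_norm_square[symmetric] flip: of_real_power)
  finally show ?thesis unfolding of_real_eq_iff by simp
qed

text \<open>Only \<open>f1\<close> has to be centred, because its constant part is evaluated exactly
  by \<open>conv_sum_const\<close>. That part raises 2 to 3, and the outer 2 comes from
  \<open>norm_diff_sq_le\<close>.\<close>

lemma sum_conv_F_le:
  "(\<Sum>x<p. (cmod (conv_F p f1 f2 x - fp_mean p f1 * fp_mean p f2))\<^sup>2)
    \<le> 2 * (3 + sqrt (7 * (real p * sqrt p))) * (energy (lift f1) * energy (lift f2)) / (real p)\<^sup>2"
proof -
  define m where "m = fp_mean p f1"
  define g where "g x = lift f1 x - m" for x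
  define K where "K = sqrt (7 * (real p * sqrt p))"
  have per: "periodic g" using periodic_lift[of f1] by (simp add: periodic_def g_def)
  have zero: "(\<Sum>x\<in>R. g x) = 0" by (simp add: g_def sum_subtractf sum_lift m_def)
  have en: "energy g + real p * (cmod m)\<^sup>2 = energy (lift f1)"
    unfolding g_def m_def by (rule energy_minus_mean)
  then have g: "energy g \<le> energy (lift f1)" by (smt (verit) mult_nonneg_nonneg of_nat_0_le_iff zero_le_power2)
  have "(cmod m)\<^sup>2 \<le> real p * (cmod m)\<^sup>2" using p_gt_1 by (simp add: mult_le_cancel_right1)
  then have m: "(cmod m)\<^sup>2 \<le> energy (lift f1)" using en energy_nonneg[of g] by linarith
  \<comment> \<open>The product of the means cancels, and only the missing term at y = 0 is left
    over.\<close>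
  have decomp: "conv_F p f1 f2 x - fp_mean p f1 * fp_mean p f2
      = (conv_sum g (lift f2) (int x) - m * lift f2 (int x)) / of_nat p" for x
  proof -
    have "conv_sum (lift f1) (lift f2) (int x) = conv_sum g (lift f2) (int x) + conv_sum (\<lambda>_. m) (lift f2) (int x)"
      unfolding conv_sum_def sum.distrib[symmetric] by (simp add: g_def algebra_simps)
    also have "\<dots> = conv_sum g (lift f2) (int x) + m * (of_nat p * fp_mean p f2 - lift f2 (int x))"
      unfolding conv_sum_const[OF periodic_lift] sum_lift ..
    finally show ?thesis using p_gt_1 by (simp add: conv_F_eq m_def field_simps)
  qed
  have "(\<Sum>x<p. (cmod (conv_F p f1 f2 x - fp_mean p f1 * fp_mean p f2))\<^sup>2)
      = (\<Sum>x\<in>R. (cmod (conv_sum g (lift f2) x - m * lift f2 x))\<^sup>2) / (real p)\<^sup>2"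
    unfolding decomp sum_R_nat by (simp add: norm_divide power_divide sum_divide_distrib)
  also have "\<dots> \<le> (\<Sum>x\<in>R. 2 * (cmod (conv_sum g (lift f2) x))\<^sup>2 + 2 * (cmod (m * lift f2 x))\<^sup>2) / (real p)\<^sup>2"
    by (intro divide_right_mono sum_mono norm_diff_sq_le) simp
  also have "(\<Sum>x\<in>R. 2 * (cmod (conv_sum g (lift f2) x))\<^sup>2 + 2 * (cmod (m * lift f2 x))\<^sup>2)
      = 2 * (\<Sum>x\<in>R. (cmod (conv_sum g (lift f2) x))\<^sup>2) + 2 * ((cmod m)\<^sup>2 * energy (lift f2))"
    by (simp add: sum.distrib sum_distrib_left energy_def norm_mult power_mult_distrib)
  also have "\<dots> \<le> 2 * ((2 + K) * (energy g * energy (lift f2))) + 2 * (energy (lift f1) * energy (lift f2))"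
    unfolding K_def by (intro add_mono mult_left_mono mult_right_mono sum_conv_sum_le per periodic_lift zero m) auto
  also have "\<dots> \<le> 2 * ((2 + K) * (energy (lift f1) * energy (lift f2))) + 2 * (energy (lift f1) * energy (lift f2))"
    by (intro add_mono mult_left_mono mult_right_mono g order_refl) (auto simp: K_def)
  also have "\<dots> = 2 * (3 + K) * (energy (lift f1) * energy (lift f2))" by (simp add: algebra_simps)
  finally show ?thesis by (simp add: K_def divide_right_mono)
qed

text \<open>The squared estimate saves p^(1/4) where only p^(1/5) is required. The left numerator is
  at most 12 p^(4/5), and 12 is rounded up to 16, the square of the final constant.\<close>

lemma constant_le: "2 * (3 + sqrt (7 * (real p * sqrt p))) / p \<le> (4 * real p powr (-1/10))\<^sup>2"
proof -
  have p: "1 \<le> real p" using p_gt_1 by simp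
  \<comment> \<open>Replacing 7 by 9 makes the constant a perfect square.\<close>
  have "sqrt (7 * (real p * sqrt p)) \<le> sqrt (9 * (real p * sqrt p))" by simp
  also have "\<dots> = 3 * real p powr (3/4)"
  proof -
    have "real p * sqrt p = real p powr 1 * real p powr (1/2)" using p by (simp add: powr_half_sqrt)
    also have "\<dots> = (real p powr (3/4))\<^sup>2" unfolding powr_add[symmetric] power2_eq_square by simp
    finally show ?thesis by (simp add: real_sqrt_mult)
  qed
  finally have "2 * (3 + sqrt (7 * (real p * sqrt p))) \<le> 2 * (3 * 1 + 3 * real p powr (3/4))" by simp
  also have "\<dots> \<le> 2 * (3 * real p powr (4/5) + 3 * real p powr (4/5))"
    using p by (intro mult_left_mono add_mono powr_mono ge_one_powr_ge_zero) auto
  also have "\<dots> \<le> 16 * real p powr (4/5)" by simp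
  also have "real p powr (4/5) = (real p powr (-1/10))\<^sup>2 * real p powr 1"
    unfolding power2_eq_square powr_add[symmetric] by simp
  finally show ?thesis using p by (simp add: divide_le_eq power_mult_distrib mult.assoc)
qed

lemma conv_F_norm_le:
  "fp_norm2 p (\<lambda>x. conv_F p f1 f2 x - fp_mean p f1 * fp_mean p f2)
    \<le> 4 * real p powr (-1/10) * fp_norm2 p f1 * fp_norm2 p f2"
proof (rule power2_le_imp_le)
  let ?E = "energy (lift f1) * energy (lift f2)"
  have "(fp_norm2 p (\<lambda>x. conv_F p f1 f2 x - fp_mean p f1 * fp_mean p f2))\<^sup>2
      = (\<Sum>x<p. (cmod (conv_F p f1 f2 x - fp_mean p f1 * fp_mean p f2))\<^sup>2) / p"
    unfolding fp_norm2_sq energy_lift ..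
  also have "\<dots> \<le> 2 * (3 + sqrt (7 * (real p * sqrt p))) * ?E / (real p)\<^sup>2 / p"
    by (intro divide_right_mono sum_conv_F_le) simp
  also have "\<dots> = 2 * (3 + sqrt (7 * (real p * sqrt p))) / p * (?E / (real p)\<^sup>2)" by simp
  also have "\<dots> \<le> (4 * real p powr (-1/10))\<^sup>2 * (?E / (real p)\<^sup>2)"
    by (intro mult_right_mono constant_le) simp
  also have "?E / (real p)\<^sup>2 = (fp_norm2 p f1)\<^sup>2 * (fp_norm2 p f2)\<^sup>2"
    unfolding fp_norm2_sq by (simp add: power2_eq_square)
  finally show "(fp_norm2 p (\<lambda>x. conv_F p f1 f2 x - fp_mean p f1 * fp_mean p f2))\<^sup>2
      \<le> (4 * real p powr (-1/10) * fp_norm2 p f1 * fp_norm2 p f2)\<^sup>2"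
    by (simp add: power_mult_distrib mult.assoc)
qed (simp add: fp_norm2_def sum_nonneg)

end

theorem theorem3p1:
  shows "\<exists>c::real. c > 0 \<and> (\<forall>(p::nat) (f1::nat \<Rightarrow> complex) (f2::nat \<Rightarrow> complex). prime p \<longrightarrow>
     fp_norm2 p (\<lambda>x. conv_F p f1 f2 x - fp_mean p f1 * fp_mean p f2)
       \<le> c * real p powr (-1/10) * fp_norm2 p f1 * fp_norm2 p f2)"
proof (intro exI[of _ 4] conjI allI impI)
  fix p :: nat and f1 f2 :: "nat \<Rightarrow> complex"
  assume "prime p"
  then interpret residues_mod_prime p by unfold_locales
  show "fp_norm2 p (\<lambda>x. conv_F p f1 f2 x - fp_mean p f1 * fp_mean p f2)
       \<le> 4 * real p powr (-1/10) * fp_norm2 p f1 * fp_norm2 p f2"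
    by (rule conv_F_norm_le)
qed simp

end
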